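(* Let $\Gamma$ be the Farey group with generators $a,b,c$, let $\|\cdot\|$ be the word metric on $\Gamma$ with respect to $\{a,b,c\}$, and set $\Gamma_n=\{\gamma\in\Gamma:\|\gamma\|=n\}$. For $x\in X=P(\mathbb{R}^2)$, $f:X\to\mathbb{R}$ and $n\in\mathbb{N}$ define $S_n(f,x)=\sum_{\gamma\in\Gamma_n}f(\gamma x)$. Then there exists a measure $\mu_{\bar{\mathcal{M}}}$ on $X$, namely the extended Minkowski measure, such that for every $x\in X$ and every continuous $f:X\to\mathbb{R}$, $$\lim_{n\to\infty}\frac{S_n(f,x)}{|\Gamma_n|}=\int_X f\,d\mu_{\bar{\mathcal{M}}}.$$
   Context: Action: $PSL(2,\mathbb{R})$ acts on the projective line $X=P(\mathbb{R}^2)$ through the linear action on $\mathbb{R}^2$. $X$ is identified with $\mathbb{R}\cup\{\infty\}$ by sending the class of $(x,y)^T$ to $x/y$ if $y\neq0$ and the class of $(1,0)^T$ to $\infty$; the action becomes the action by Möbius transformations $z\mapsto\frac{\alpha z+\beta}{\gamma z+\delta}$. Farey group: the subgroup $\Gamma$ of $PSL(2,\mathbb{Z})$ generated by the classes of $$a=\begin{pmatrix}1&-2\\1&-1\end{pmatrix},\quad b=\begin{pmatrix}0&-1\\1&0\end{pmatrix},\quad c=\begin{pmatrix}1&-1\\2&-1\end{pmatrix}.$$ Word metric: for a group $G$ generated by $S$, $\|e\|=0$ and, for $g\neq e$, $\|g\|=\min\{n: g=s_1\cdots s_n,\ s_i\in S\}$. Farey sequences: for rationals in lowest terms with positive denominators,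 $\frac{p_1}{q_1}\oplus\frac{p_2}{q_2}=\frac{p_1+p_2}{q_1+q_2}$. Set $\mathscr{F}_0=(0,1)$ (with $0=\frac01$, $1=\frac11$), and let $\mathscr{F}_{n+1}$ be obtained from $\mathscr{F}_n$ by inserting $s\oplus t$ between every two consecutive terms $s,t$. Each $\mathscr{F}_n$ is increasing and has $2^n+1$ terms. Minkowski function: $\mathcal{M}:[0,1]\to[0,1]$ is the unique continuous function such that $\mathcal{M}(q)=k/2^n$ whenever $q$ is the $(k+1)$-th term of $\mathscr{F}_n$ (this does not depend on the choice of $n$). Extended Minkowski measure: for $n\in\mathbb{Z}$ and $q\in[n,n+1)$, with $\{q\}$ the fractional part, let $$\bar{\mathcal{M}}(q)=\frac13\left(\sum_{k=-\infty}^{n-1}\frac1{2^{|k|}}+\frac{\mathcal{M}(\{q\})}{2^{|n|}}\right).$$ Then $\mu_{\bar{\mathcal{M}}}$ is the Borel probability measure on $\mathbb{R}$ with $\mu_{\bar{\mathcal{M}}}([s,t))=\bar{\mathcal{M}}(t)-\bar{\mathcal{M}}(s)$ for $s<t$, viewed as a measure on $X=\mathbb{R}\cup\{\infty\}$ giving mass $0$ to $\infty$. *)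

theory Defs
  imports "HOL-Probability.Probability_Measure" "HOL-Algebra.Generated_Groups"
begin

section \<open>The groups PSL(2,R) and PSL(2,Z)\<close>

definition SL2R :: "(real^2^2) monoid" where
  "SL2R = \<lparr>carrier = {A. det A = 1}, mult = (**), one = mat 1\<rparr>"

definition SL2Z :: "(real^2^2) monoid" where
  "SL2Z = SL2R\<lparr>carrier := {A. det A = 1 \<and> (\<forall>i j. A $ i $ j \<in> \<int>)}\<rparr>"

definition sign_group :: "(real^2^2) set" where
  "sign_group = {mat 1, - mat 1}"

text \<open>Elements of both groups are cosets \<open>{A, - A}\<close> of real matrices, so the carrier of
  \<open>PSL2Z\<close> is a subset of the carrier of \<open>PSL2R\<close>.\<close>

definition PSL2R :: "(real^2^2) set monoid" where
  "PSL2R = SL2R Mod sign_group"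

definition PSL2Z :: "(real^2^2) set monoid" where
  "PSL2Z = SL2Z Mod sign_group"

definition psl :: "real^2^2 \<Rightarrow> (real^2^2) set" where
  "psl A = sign_group #>\<^bsub>SL2R\<^esub> A"

section \<open>The projective line and its action\<close>

definition proj_line :: "(real^2) set set" where
  "proj_line = {span {v} | v. v \<noteq> 0}"

text \<open>The quotient topology with respect to \<open>v \<mapsto> span {v}\<close> on the nonzero vectors, an open
  subset of the plane; see \<open>quotient_map_proj_line\<close> below.\<close>

definition proj_top :: "(real^2) set topology" where
  "proj_top = topology (\<lambda>U. U \<subseteq> proj_line \<and> open {v. v \<noteq> 0 \<and> span {v} \<in> U})"

definition proj_borel :: "(real^2) set measure" where
  "proj_borel = sigma proj_line {U. openin proj_top U}"

text \<open>The identification of \<open>proj_line\<close> with the reals and a point at infinity: the line through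
  \<open>(x, y)\<close> with \<open>y \<noteq> 0\<close> corresponds to \<open>x / y\<close>.\<close>

definition proj_of_real :: "real \<Rightarrow> (real^2) set" where
  "proj_of_real t = span {vector [t, 1]}"

definition proj_infinity :: "(real^2) set" where
  "proj_infinity = span {vector [1, 0]}"

text \<open>The two representatives of \<open>g\<close> differ by a sign and give the same image of a line, so the
  union over all representatives is the image under any one of them; see \<open>proj_act_psl\<close>
  below.\<close>

definition proj_act :: "(real^2^2) set \<Rightarrow> (real^2) set \<Rightarrow> (real^2) set" where
  "proj_act g L = {A *v v | A v. A \<in> g \<and> v \<in> L}"

section \<open>The Farey group and its word metric\<close>

definition farey_a :: "real^2^2" where
  "farey_a = vector [vector [1, -2], vector [1, -1]]"

definition farey_b :: "real^2^2" where
  "farey_b = vector [vector [0, -1], vector [1, 0]]"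

definition farey_c :: "real^2^2" where
  "farey_c = vector [vector [1, -1], vector [2, -1]]"

definition farey_gens :: "(real^2^2) set set" where
  "farey_gens = {psl farey_a, psl farey_b, psl farey_c}"

definition farey_group :: "(real^2^2) set monoid" where
  "farey_group = subgroup_generated PSL2Z farey_gens"

definition word_norm :: "('a, 'b) monoid_scheme \<Rightarrow> 'a set \<Rightarrow> 'a \<Rightarrow> nat" where
  "word_norm G S g =
     (if g = \<one>\<^bsub>G\<^esub> then 0
      else LEAST n. \<exists>ss. length ss = n \<and> set ss \<subseteq> S \<and> g = foldr (mult G) ss \<one>\<^bsub>G\<^esub>)"

definition farey_sphere :: "nat \<Rightarrow> (real^2^2) set set" where
  "farey_sphere n = {\<gamma> \<in> carrier farey_group. word_norm farey_group farey_gens \<gamma> = n}"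

definition sphere_sum :: "nat \<Rightarrow> ((real^2) set \<Rightarrow> real) \<Rightarrow> (real^2) set \<Rightarrow> real" where
  "sphere_sum n f x = (\<Sum>\<gamma>\<in>farey_sphere n. f (proj_act \<gamma> x))"

section \<open>The Minkowski function and the extended Minkowski measure\<close>

text \<open>\<open>quotient_of\<close> returns the representation in lowest terms with positive denominator.\<close>

definition mediant :: "rat \<Rightarrow> rat \<Rightarrow> rat" where
  "mediant s t =
     Fract (fst (quotient_of s) + fst (quotient_of t)) (snd (quotient_of s) + snd (quotient_of t))"

fun insert_mediants :: "rat list \<Rightarrow> rat list" where
  "insert_mediants (s # t # xs) = s # mediant s t # insert_mediants (t # xs)"
| "insert_mediants xs = xs"

primrec farey_seq :: "nat \<Rightarrow> rat list" where
  "farey_seq 0 = [0, 1]"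
| "farey_seq (Suc n) = insert_mediants (farey_seq n)"

text \<open>The function is determined on \<open>[0,1]\<close>; the extensional function space fixes an irrelevant
  value elsewhere so that the description is unique. List indices start at 0, so
  \<open>farey_seq n ! k\<close> is the \<open>(k+1)\<close>-th term.\<close>

definition minkowski :: "real \<Rightarrow> real" where
  "minkowski = (THE M. M \<in> {0..1} \<rightarrow>\<^sub>E {0..1} \<and> continuous_on {0..1} M \<and>
     (\<forall>n. \<forall>k < length (farey_seq n). M (of_rat (farey_seq n ! k)) = real k / 2 ^ n))"

definition extended_minkowski :: "real \<Rightarrow> real" where
  "extended_minkowski q =
     1/3 * ((\<Sum>\<^sub>\<infinity>k\<in>{..\<lfloor>q\<rfloor> - 1}. 1 / 2 ^ nat \<bar>k\<bar>) + minkowski (frac q) / 2 ^ nat \<bar>\<lfloor>q\<rfloor>\<bar>)"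

definition extended_minkowski_measure :: "(real^2) set measure \<Rightarrow> bool" where
  "extended_minkowski_measure \<mu> \<longleftrightarrow>
     prob_space \<mu> \<and> space \<mu> = proj_line \<and> sets \<mu> = sets proj_borel \<and>
     measure \<mu> {proj_infinity} = 0 \<and>
     (\<forall>s t. s < t \<longrightarrow>
        measure \<mu> (proj_of_real ` {s..<t}) = extended_minkowski t - extended_minkowski s)"

section \<open>Basic facts\<close>

lemma openin_proj_top:
  "openin proj_top U \<longleftrightarrow> U \<subseteq> proj_line \<and> open {v. v \<noteq> 0 \<and> span {v} \<in> U}"
proof -
  have "istopology (\<lambda>U. U \<subseteq> proj_line \<and> open {v. v \<noteq> 0 \<and> span {v} \<in> U})"
    unfolding istopology_def
  proof (intro conjI allI impI; (elim conjE)?)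
    fix S T :: "(real^2) set set"
    assume "open {v. v \<noteq> 0 \<and> span {v} \<in> S}" "open {v. v \<noteq> 0 \<and> span {v} \<in> T}"
    then have "open ({v. v \<noteq> 0 \<and> span {v} \<in> S} \<inter> {v. v \<noteq> 0 \<and> span {v} \<in> T})"
      by (rule open_Int)
    then show "open {v. v \<noteq> 0 \<and> span {v} \<in> S \<inter> T}"
      by (rule back_subst[where P = "open"]) auto
  next
    fix K :: "(real^2) set set set"
    assume "\<forall>S\<in>K. S \<subseteq> proj_line \<and> open {v. v \<noteq> 0 \<and> span {v} \<in> S}"
    then have "open (\<Union>S\<in>K. {v. v \<noteq> 0 \<and> span {v} \<in> S})"
      by (intro open_UN) auto
    then show "open {v. v \<noteq> 0 \<and> span {v} \<in> \<Union>K}"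
      by (rule back_subst[where P = "open"]) auto
  qed auto
  then show ?thesis
    by (simp add: proj_top_def topology_inverse')
qed

lemma topspace_proj_top: "topspace proj_top = proj_line"
proof -
  have "{v. v \<noteq> 0 \<and> span {v} \<in> proj_line} = - {0 :: real^2}"
    by (auto simp: proj_line_def)
  then have "openin proj_top proj_line"
    by (auto simp: openin_proj_top open_Compl)
  then show ?thesis
    by (metis openin_proj_top openin_subset openin_topspace subset_antisym)
qed

lemma quotient_map_proj_line:
  "quotient_map (top_of_set (- {0})) proj_top (\<lambda>v. span {v})"
  unfolding quotient_map_def topspace_proj_top
proof (intro conjI allI impI)
  show "(\<lambda>v. span {v}) ` topspace (top_of_set (- {0})) = proj_line"
    by (auto simp: proj_line_def)
next
  fix U :: "(real^2) set set"
  assume "U \<subseteq> proj_line"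
  have "{x \<in> topspace (top_of_set (- {0})). span {x} \<in> U} = {v. v \<noteq> 0 \<and> span {v} \<in> U}"
    by auto
  then show "openin (top_of_set (- {0})) {x \<in> topspace (top_of_set (- {0})). span {x} \<in> U} \<longleftrightarrow>
    openin proj_top U"
    using \<open>U \<subseteq> proj_line\<close> by (auto simp: openin_proj_top openin_open_eq open_Compl)
qed

lemma matrix_mul_uminus:
  fixes A B :: "real^2^2"
  shows "(- A) ** B = - (A ** B)" "A ** (- B) = - (A ** B)"
  by (simp_all add: vec_eq_iff matrix_matrix_mult_def sum_negf)

lemma psl_eq: "psl A = {A, - A}"
  by (auto simp: psl_def sign_group_def r_coset_def SL2R_def matrix_mul_uminus)

lemma proj_act_psl:
  assumes "L \<in> proj_line"
  shows "proj_act (psl A) L = (\<lambda>v. A *v v) ` L"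
proof -
  have neg: "- v \<in> L" if "v \<in> L" for v
    using assms that by (auto simp: proj_line_def span_neg)
  have "(- A) *v v = A *v (- v)" for v
    by (simp add: vec_eq_iff matrix_vector_mult_def sum_negf)
  then show ?thesis
    using neg by (fastforce simp: proj_act_def psl_eq)
qed

lemma proj_line_eq: "proj_line = insert proj_infinity (range proj_of_real)"
proof (intro equalityI subsetI)
  fix L assume "L \<in> proj_line"
  then obtain v :: "real^2" where v: "L = span {v}" "v \<noteq> 0" by (auto simp: proj_line_def)
  have scale: "span {w} = span {v}" if "w = c *\<^sub>R v" "c \<noteq> 0" for c and w :: "real^2"
    using span_image_scale[of "{v}" "\<lambda>_. c"] that by simp
  show "L \<in> insert proj_infinity (range proj_of_real)"
  proof (cases "v $ 2 = 0")
    case True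
    then have "v $ 1 \<noteq> 0" using v(2) by (auto simp: vec_eq_iff forall_2)
    then have "span {vector [1, 0]} = span {v}"
      using True by (intro scale[of _ "1 / v $ 1"]) (auto simp: vec_eq_iff forall_2)
    then show ?thesis using v by (simp add: proj_infinity_def)
  next
    case False
    then have "span {vector [v $ 1 / v $ 2, 1]} = span {v}"
      by (intro scale[of _ "1 / v $ 2"]) (auto simp: vec_eq_iff forall_2)
    then have "L = proj_of_real (v $ 1 / v $ 2)" using v by (simp add: proj_of_real_def)
    then show ?thesis by blast
  qed
qed (force simp: proj_line_def proj_of_real_def proj_infinity_def vec_eq_iff forall_2)

lemma proj_act_proj_of_real:
  assumes "A $ 2 $ 1 * t + A $ 2 $ 2 \<noteq> 0"
  shows "proj_act (psl A) (proj_of_real t) =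
    proj_of_real ((A $ 1 $ 1 * t + A $ 1 $ 2) / (A $ 2 $ 1 * t + A $ 2 $ 2))"
proof -
  let ?d = "A $ 2 $ 1 * t + A $ 2 $ 2" and ?m = "(A $ 1 $ 1 * t + A $ 1 $ 2) / (A $ 2 $ 1 * t + A $ 2 $ 2)"
  have "A *v vector [t, 1] = ?d *\<^sub>R vector [?m, 1]"
    using assms by (simp add: vec_eq_iff forall_2 matrix_vector_mult_def sum_2)
  moreover have "span {?d *\<^sub>R vector [?m, 1] :: real^2} = span {vector [?m, 1]}"
    using span_image_scale[of "{vector [?m, 1] :: real^2}" "\<lambda>_. ?d"] assms by simp
  moreover have "(\<lambda>v. A *v v) ` span {vector [t, 1]} = span {A *v vector [t, 1]}"
    using linear_span_image[OF matrix_vector_mul_linear[of A], of "{vector [t, 1]}"] by simp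
  ultimately show ?thesis
    by (simp add: proj_act_psl proj_line_eq) (simp add: proj_of_real_def)
qed

lemma det_uminus_2: "det (- A :: real^2^2) = det A"
  by (simp add: det_2)

lemma group_SL2R: "group SL2R"
proof (rule groupI)
  fix A assume "A \<in> carrier SL2R"
  then have d: "det A = 1" by (simp add: SL2R_def)
  then obtain B where B: "A ** B = mat 1" "B ** A = mat 1"
    using invertible_det_nz[of A] by (auto simp: invertible_def)
  have "det B = 1"
    using arg_cong[OF B(1), of det] d by (simp add: det_mul)
  then show "\<exists>B\<in>carrier SL2R. B \<otimes>\<^bsub>SL2R\<^esub> A = \<one>\<^bsub>SL2R\<^esub>"
    using B by (auto simp: SL2R_def)
qed (auto simp: SL2R_def det_mul matrix_mul_assoc)

lemma subgroup_SL2Z: "subgroup (carrier SL2Z) SL2R"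
proof (rule group.subgroupI[OF group_SL2R])
  show "carrier SL2Z \<subseteq> carrier SL2R" by (auto simp: SL2Z_def SL2R_def)
  have "mat 1 \<in> carrier SL2Z" by (simp add: SL2Z_def) (simp add: mat_def)
  then show "carrier SL2Z \<noteq> {}" by auto
next
  fix A assume A: "A \<in> carrier SL2Z"
  define B :: "real^2^2" where "B = vector [vector [A$2$2, - A$1$2], vector [- A$2$1, A$1$1]]"
  have d: "det A = 1" using A by (simp add: SL2Z_def)
  have B: "B \<in> carrier SL2Z"
    using A by (simp add: SL2Z_def B_def forall_2 det_2 mult.commute)
  have "B ** A = mat 1"
    using d by (simp add: B_def vec_eq_iff matrix_matrix_mult_def sum_2 forall_2 mat_def det_2
        algebra_simps)
  then have "inv\<^bsub>SL2R\<^esub> A = B"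
    using A B d by (intro group.inv_equality[OF group_SL2R]) (auto simp: SL2R_def SL2Z_def)
  then show "inv\<^bsub>SL2R\<^esub> A \<in> carrier SL2Z" using B by simp
next
  fix A B assume "A \<in> carrier SL2Z" "B \<in> carrier SL2Z"
  then show "A \<otimes>\<^bsub>SL2R\<^esub> B \<in> carrier SL2Z"
    by (auto simp: SL2Z_def SL2R_def det_mul, auto simp: matrix_matrix_mult_def)
qed

lemma group_SL2Z: "group SL2Z"
  using subgroup.subgroup_is_group[OF subgroup_SL2Z group_SL2R] by (simp add: SL2Z_def)

lemma normal_sign_group:
  shows "sign_group \<lhd> SL2R" "sign_group \<lhd> SL2Z"
proof -
  have sub: "subgroup sign_group G"
    if "group G" "mult G = (**)" "one G = mat 1" "sign_group \<subseteq> carrier G" for G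
  proof (rule group.subgroupI[OF \<open>group G\<close>])
    fix A assume "A \<in> sign_group"
    then have "inv\<^bsub>G\<^esub> A = A"
      using that by (intro group.inv_equality) (auto simp: sign_group_def matrix_mul_uminus)
    then show "inv\<^bsub>G\<^esub> A \<in> sign_group" using \<open>A \<in> sign_group\<close> by simp
  qed (use that in \<open>auto simp: sign_group_def matrix_mul_uminus\<close>)
  have norm: "sign_group \<lhd> G"
    if "group G" "mult G = (**)" "one G = mat 1" "sign_group \<subseteq> carrier G" for G
    using group.normalI[OF that(1) sub[OF that]] that
    by (auto simp: sign_group_def r_coset_def l_coset_def matrix_mul_uminus)
  show "sign_group \<lhd> SL2R"
    by (rule norm[OF group_SL2R]) (auto simp: SL2R_def sign_group_def det_uminus_2)
  show "sign_group \<lhd> SL2Z"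
    by (rule norm[OF group_SL2Z])
      (auto simp: SL2Z_def SL2R_def sign_group_def det_uminus_2, auto simp: mat_def)
qed

lemma group_PSL2R: "group PSL2R"
  unfolding PSL2R_def by (rule normal.factorgroup_is_group[OF normal_sign_group(1)])

lemma group_PSL2Z: "group PSL2Z"
  unfolding PSL2Z_def by (rule normal.factorgroup_is_group[OF normal_sign_group(2)])

lemma carrier_PSL:
  "carrier PSL2R = psl ` carrier SL2R"
  "carrier PSL2Z = psl ` carrier SL2Z"
  by (auto simp: PSL2R_def PSL2Z_def FactGroup_def RCOSETS_def psl_def r_coset_def SL2Z_def)

lemma mult_PSL:
  "mult PSL2Z = mult PSL2R"
  "psl A \<otimes>\<^bsub>PSL2R\<^esub> psl B = psl (A ** B)"
proof -
  show "mult PSL2Z = mult PSL2R"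
    by (simp add: PSL2R_def PSL2Z_def FactGroup_def SL2Z_def set_mult_def fun_eq_iff)
  show "psl A \<otimes>\<^bsub>PSL2R\<^esub> psl B = psl (A ** B)"
    by (auto simp: PSL2R_def FactGroup_def set_mult_def psl_eq SL2R_def matrix_mul_uminus)
qed

lemma farey_gens_subset: "farey_gens \<subseteq> carrier PSL2Z"
proof -
  have "farey_a \<in> carrier SL2Z" "farey_b \<in> carrier SL2Z" "farey_c \<in> carrier SL2Z"
    by (simp_all add: SL2Z_def farey_a_def farey_b_def farey_c_def det_2 forall_2)
  then show ?thesis by (auto simp: farey_gens_def carrier_PSL)
qed

lemma length_farey_seq: "length (farey_seq n) = 2 ^ n + 1"
proof -
  have ins: "xs \<noteq> [] \<Longrightarrow> length (insert_mediants xs) = 2 * length xs - 1" for xs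
    by (induction xs rule: insert_mediants.induct) auto
  show ?thesis
  proof (induction n)
    case (Suc n)
    then have "farey_seq n \<noteq> []" by auto
    then show ?case using ins Suc by simp
  qed simp
qed

end

theory Submission
  imports Defs "HOL-Probability.Distribution_Functions"
begin

text \<open>
The three generators are involutions, the half-turns of the hyperbolic plane about points on the
sides of the ideal triangle with vertices \<open>0\<close>, \<open>1\<close>, \<open>\<infinity>\<close>. On the circle \<open>P(\<real>\<^sup>2)\<close> each of them
exchanges the arc that its side cuts off, which is \<open>[1, \<infinity>]\<close> for \<open>a\<close>, \<open>[\<infinity>, 0]\<close> for \<open>b\<close> and
\<open>[0, 1]\<close> for \<open>c\<close>, with the rest of the circle. By ping-pong the group is the free product of
three groups of order 2, so its sphere of radius \<open>n > 0\<close> is parametrised by the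
\<open>3 * 2 ^ (n - 1)\<close> words of length \<open>n\<close> without repeated neighbours
(\<open>bij_reduced_words_sphere\<close>, \<open>card_reduced_words\<close>).

To a reduced word \<open>u @ [s]\<close> belongs the image of the arc of \<open>s\<close> under \<open>u\<close>. One more letter
replaces an arc by one of its two halves, cut at the Farey mediant of the endpoints, so the words
of length \<open>m + 1\<close> yield Farey arcs of depth \<open>m\<close> (\<open>farey_arc_word\<close>). Three facts on
these arcs prove the theorem.

\<^item> They have equal mass \<open>1 / (3 * 2 ^ m)\<close>, since the Minkowski function halves mass at every mediant
  (\<open>measure_farey_arc\<close>).

\<^item> They shrink uniformly as \<open>m\<close> grows, because the endpoints are spanned by integer vectors \<open>v\<close>, \<open>w\<close> of
  determinant 1 and growing length, so that the sine \<open>1 / (|v| |w|)\<close> of the angle between them tends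
  to 0. A continuous function is therefore almost constant on each of them
  (\<open>oscillation_on_farey_arcs\<close>).

\<^item> For every reduced word \<open>u @ w\<close> and every point \<open>x\<close>, the point \<open>u w x\<close> lies in the arc of \<open>u\<close>,
  unless \<open>w x\<close> is interior to the arc of the last letter of \<open>u\<close>. Read backwards, this exceptional
  condition determines every letter of \<open>w\<close>, one after the other, from \<open>x\<close>; so there is at most one
  exceptional \<open>w\<close> of given length for each \<open>u\<close> (\<open>exceptional_word_unique\<close>).

With \<open>m\<close> fixed, both the integral and, for large \<open>n\<close>, the sphere average are thus close to the
average of the function over one endpoint of each arc of depth \<open>m\<close>.
\<close>

section \<open>Farey sequences\<close>

lemma insert_mediants_nth:
  "k < length xs \<Longrightarrow> insert_mediants xs ! (2 * k) = xs ! k"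
  "Suc k < length xs \<Longrightarrow> insert_mediants xs ! Suc (2 * k) = mediant (xs ! k) (xs ! Suc k)"
proof (induction xs arbitrary: k rule: insert_mediants.induct)
  case (1 s t xs)
  { case 1 then show ?case using "1.IH" by (cases k) auto }
  { case 2 then show ?case using "1.IH" by (cases k) auto }
qed auto

definition farey_num :: "nat \<Rightarrow> nat \<Rightarrow> int" where
  "farey_num n k = fst (quotient_of (farey_seq n ! k))"

definition farey_den :: "nat \<Rightarrow> nat \<Rightarrow> int" where
  "farey_den n k = snd (quotient_of (farey_seq n ! k))"

definition farey_point :: "nat \<Rightarrow> nat \<Rightarrow> real" where
  "farey_point n k = of_rat (farey_seq n ! k)"

lemma farey_den_pos: "farey_den n k > 0"
  unfolding farey_den_def by (rule quotient_of_denom_pos')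

lemma farey_point_eq: "farey_point n k = farey_num n k / farey_den n k"
proof -
  have "farey_seq n ! k = of_int (farey_num n k) / of_int (farey_den n k)"
    by (rule quotient_of_div) (simp add: farey_num_def farey_den_def)
  then show ?thesis by (simp add: farey_point_def of_rat_divide)
qed

lemma farey_seq_Suc_even: "k \<le> 2 ^ n \<Longrightarrow> farey_seq (Suc n) ! (2 * k) = farey_seq n ! k"
  by (simp add: insert_mediants_nth length_farey_seq)

lemma farey_even:
  assumes "k \<le> 2 ^ n"
  shows "farey_num (Suc n) (2 * k) = farey_num n k" "farey_den (Suc n) (2 * k) = farey_den n k"
    "farey_point (Suc n) (2 * k) = farey_point n k"
  using farey_seq_Suc_even[OF assms] by (simp_all add: farey_num_def farey_den_def farey_point_def)

text \<open>The determinant of two neighbours is 1, which makes the mediant's numerator and denominator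
  coprime. So the mediant really adds the vectors \<open>(p, q)\<close> that represent the fractions.\<close>

lemma quotient_of_mediant:
  assumes "fst (quotient_of t) * snd (quotient_of s) - fst (quotient_of s) * snd (quotient_of t) = 1"
  shows "quotient_of (mediant s t) =
    (fst (quotient_of s) + fst (quotient_of t), snd (quotient_of s) + snd (quotient_of t))"
proof -
  obtain p q p' q' where e: "quotient_of s = (p, q)" "quotient_of t = (p', q')"
    by (metis surj_pair)
  have pos: "q > 0" "q' > 0" using e quotient_of_denom_pos by blast+
  have "p' * q - p * q' = 1" using assms e by simp
  then have "q * (p + p') - p * (q + q') = 1" by (simp add: algebra_simps)
  then have "coprime (p + p') (q + q')"
    by (metis coprimeI dvd_diff dvd_mult)
  then show ?thesis
    using e pos by (simp add: mediant_def quotient_of_Fract normalize_stable)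
qed

text \<open>The terms with odd index are the inserted mediants. The determinant condition is proved
  for all neighbours afterwards, by an induction that uses this recursion.\<close>

lemma farey_odd_aux:
  assumes "k < 2 ^ n" "farey_num n (Suc k) * farey_den n k - farey_num n k * farey_den n (Suc k) = 1"
  shows "farey_num (Suc n) (Suc (2 * k)) = farey_num n k + farey_num n (Suc k)"
    "farey_den (Suc n) (Suc (2 * k)) = farey_den n k + farey_den n (Suc k)"
proof -
  have "farey_seq (Suc n) ! Suc (2 * k) = mediant (farey_seq n ! k) (farey_seq n ! Suc k)"
    using assms(1) by (simp add: insert_mediants_nth length_farey_seq)
  then show "farey_num (Suc n) (Suc (2 * k)) = farey_num n k + farey_num n (Suc k)"
    "farey_den (Suc n) (Suc (2 * k)) = farey_den n k + farey_den n (Suc k)"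
    using quotient_of_mediant assms(2) by (simp_all add: farey_num_def farey_den_def)
qed

lemma less_two_power_Suc_cases:
  assumes "(k::nat) < 2 ^ Suc n"
  obtains l where "l < 2 ^ n" "k = 2 * l" | l where "l < 2 ^ n" "k = Suc (2 * l)"
proof -
  have "k div 2 < 2 ^ n" using assms by simp
  then show thesis
    using that by (metis odd_two_times_div_two_succ even_two_times_div_two Suc_eq_plus1)
qed

lemma farey_det:
  "k < 2 ^ n \<Longrightarrow> farey_num n (Suc k) * farey_den n k - farey_num n k * farey_den n (Suc k) = 1"
proof (induction n arbitrary: k)
  case 0
  then show ?case by (simp add: farey_num_def farey_den_def)
next
  case (Suc n)
  from Suc.prems show ?case
  proof (cases rule: less_two_power_Suc_cases)
    case (1 l)
    then show ?thesis
      using Suc.IH[of l] by (simp add: farey_even farey_odd_aux) (simp add: algebra_simps)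
  next
    case (2 l)
    have "Suc (Suc (2 * l)) = 2 * Suc l" by simp
    then show ?thesis
      using Suc.IH[of l] farey_even[of "Suc l" n] 2
      by (simp add: farey_odd_aux) (simp add: algebra_simps)
  qed
qed

lemmas farey_odd = farey_odd_aux[OF _ farey_det]

lemma farey_ends: "farey_point n 0 = 0" "farey_point n (2 ^ n) = 1"
proof -
  have "farey_seq n ! 0 = 0 \<and> farey_seq n ! (2 ^ n) = 1"
  proof (induction n)
    case (Suc n)
    then show ?case using farey_seq_Suc_even[of 0 n] farey_seq_Suc_even[of "2 ^ n" n] by simp
  qed simp
  then show "farey_point n 0 = 0" "farey_point n (2 ^ n) = 1" by (simp_all add: farey_point_def)
qed

lemma farey_gap:
  assumes "k < 2 ^ n"
  shows "farey_point n (Suc k) - farey_point n k = 1 / (farey_den n k * farey_den n (Suc k))"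
proof -
  let ?q = "real_of_int (farey_den n k)" and ?q' = "real_of_int (farey_den n (Suc k))"
  have "?q > 0" "?q' > 0" using farey_den_pos by simp_all
  moreover have "farey_num n (Suc k) * ?q - farey_num n k * ?q' = 1"
    using farey_det[OF assms] by (metis of_int_1 of_int_diff of_int_mult)
  ultimately show ?thesis by (simp add: farey_point_eq diff_frac_eq)
qed

text \<open>Of two neighbours at least one is a new mediant, whose denominator exceeds the denominator of
  the old term that it replaces; hence the sum of the denominators grows with every step. As the
  gap is the reciprocal of the product of the denominators, the gaps tend to 0.\<close>

lemma farey_den_sum: "k < 2 ^ n \<Longrightarrow> farey_den n k + farey_den n (Suc k) \<ge> int n + 2"
proof (induction n arbitrary: k)
  case 0
  then show ?case by (simp add: farey_den_def)
next
  case (Suc n)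
  from Suc.prems show ?case
  proof (cases rule: less_two_power_Suc_cases)
    case (1 l)
    then show ?thesis
      using Suc.IH[of l] farey_den_pos[of n l] by (simp add: farey_even farey_odd)
  next
    case (2 l)
    have "Suc (Suc (2 * l)) = 2 * Suc l" by simp
    then show ?thesis
      using Suc.IH[of l] farey_even[of "Suc l" n] 2 farey_den_pos[of n "Suc l"]
      by (simp add: farey_odd)
  qed
qed

lemma farey_gap_le:
  assumes "k < 2 ^ n"
  shows "farey_point n (Suc k) - farey_point n k \<le> 1 / (real n + 1)"
proof -
  let ?q = "farey_den n k" and ?q' = "farey_den n (Suc k)"
  have "(?q - 1) * (?q' - 1) \<ge> 0" using farey_den_pos[of n k] farey_den_pos[of n "Suc k"] by simp
  then have "?q * ?q' \<ge> int n + 1" using farey_den_sum[OF assms] by (simp add: algebra_simps)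
  then have "real n + 1 \<le> real_of_int (?q * ?q')" by linarith
  then show ?thesis unfolding farey_gap[OF assms] by (intro divide_left_mono) auto
qed

lemma farey_gap_pos: "k < 2 ^ n \<Longrightarrow> farey_point n k < farey_point n (Suc k)"
  using farey_gap[of k n] farey_den_pos[of n k] farey_den_pos[of n "Suc k"]
  by (smt (verit) divide_pos_pos of_int_0_less_iff mult_pos_pos)

lemma farey_point_less:
  assumes "j < k" "k \<le> 2 ^ n"
  shows "farey_point n j < farey_point n k"
  using assms
proof (induction k rule: less_induct)
  case (less k)
  obtain i where i: "k = Suc i" using less.prems by (cases k) auto
  show ?case
    using less i farey_gap_pos[of i n] by (cases "j = i") force+
qed

lemma farey_point_le_iff:
  assumes "j \<le> 2 ^ n" "k \<le> 2 ^ n"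
  shows "farey_point n j \<le> farey_point n k \<longleftrightarrow> j \<le> k"
  using farey_point_less assms by (metis linorder_not_less nless_le)

lemma farey_point_range: "k \<le> 2 ^ n \<Longrightarrow> farey_point n k \<in> {0..1}"
  using farey_point_le_iff[of 0 n k] farey_point_le_iff[of k n "2 ^ n"] by (simp add: farey_ends)

lemma farey_refine: "k \<le> 2 ^ n \<Longrightarrow> farey_point (n + i) (2 ^ i * k) = farey_point n k"
proof (induction i)
  case (Suc i)
  have "2 ^ i * k \<le> 2 ^ (n + i)" using Suc.prems by (simp add: power_add)
  then show ?case using Suc farey_even(3)[of "2 ^ i * k" "n + i"] by (simp add: mult.assoc)
qed simp

text \<open>Both points occur in a common later sequence, where the order of the points is the order of
  the indices.\<close>

lemma farey_point_le_dyadic: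
  assumes "k \<le> 2 ^ n" "l \<le> 2 ^ m" "farey_point n k \<le> farey_point m l"
  shows "real k / 2 ^ n \<le> real l / 2 ^ m"
proof -
  have "2 ^ m * k \<le> 2 ^ (n + m)" "2 ^ n * l \<le> 2 ^ (n + m)" using assms by (simp_all add: power_add)
  moreover have "farey_point (n + m) (2 ^ m * k) \<le> farey_point (n + m) (2 ^ n * l)"
    using farey_refine[of k n m] farey_refine[of l m n] assms by (simp add: add.commute)
  ultimately have "2 ^ m * k \<le> 2 ^ n * l" by (simp add: farey_point_le_iff)
  then have "real (2 ^ m * k) \<le> real (2 ^ n * l)" by (simp only: of_nat_le_iff)
  then show ?thesis by (simp add: field_simps)
qed

text \<open>The consecutive points cover the unit interval: otherwise \<open>x\<close> would pass every point of
  the sequence, including the last one, 1.\<close>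

lemma farey_cell:
  assumes "0 \<le> x" "x \<le> 1"
  obtains k where "k < 2 ^ n" "farey_point n k \<le> x" "x \<le> farey_point n (Suc k)"
proof -
  have "\<exists>k<2 ^ n. farey_point n k \<le> x \<and> x \<le> farey_point n (Suc k)"
  proof (rule ccontr)
    assume no: "\<not> ?thesis"
    have "k \<le> 2 ^ n \<Longrightarrow> farey_point n k \<le> x \<and> (k = 0 \<or> farey_point n k < x)" for k
    proof (induction k)
      case 0
      then show ?case using assms by (simp add: farey_ends)
    next
      case (Suc k)
      then show ?case using no by force
    qed
    from this[of "2 ^ n"] show False using assms by (simp add: farey_ends)
  qed
  then show thesis using that by blast
qed

section \<open>The Minkowski function\<close>

text \<open>A monotone extension of the prescribed values at the Farey points. It turns out to be
  continuous, and density of the Farey points makes it the only continuous solution.\<close>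

definition question_mark :: "real \<Rightarrow> real" where
  "question_mark x = Sup {real k / 2 ^ n | n k. k \<le> 2 ^ n \<and> farey_point n k \<le> x}"

lemma question_mark_bdd: "bdd_above {real k / 2 ^ n | n k. k \<le> 2 ^ n \<and> farey_point n k \<le> x}"
proof -
  have "real k / 2 ^ n \<le> 1" if "k \<le> 2 ^ n" for k n :: nat
    using that by (simp add: divide_le_eq)
  then show ?thesis by (intro bdd_aboveI[of _ 1]) auto
qed

lemma question_mark_farey_point:
  assumes "k \<le> 2 ^ n"
  shows "question_mark (farey_point n k) = real k / 2 ^ n"
  unfolding question_mark_def
proof (rule cSup_eq_maximum)
  fix y assume "y \<in> {real l / 2 ^ m | m l. l \<le> 2 ^ m \<and> farey_point m l \<le> farey_point n k}"
  then show "y \<le> real k / 2 ^ n" using farey_point_le_dyadic assms by blast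
qed (use assms in blast)

lemma question_mark_mono:
  assumes "0 \<le> x" "x \<le> y"
  shows "question_mark x \<le> question_mark y"
  unfolding question_mark_def
proof (rule cSup_subset_mono[OF _ question_mark_bdd])
  have "farey_point 0 0 \<le> x" using farey_ends[of 0] assms by simp
  then show "{real k / 2 ^ n | n k. k \<le> 2 ^ n \<and> farey_point n k \<le> x} \<noteq> {}" by blast
qed (use assms in force)

lemma question_mark_range: "x \<in> {0..1} \<Longrightarrow> question_mark x \<in> {0..1}"
  using question_mark_mono[of 0 x] question_mark_mono[of x 1]
    question_mark_farey_point[of 0 0] question_mark_farey_point[of 1 0] farey_ends[of 0]
  by simp

text \<open>Points closer than the smallest gap of level \<open>n\<close> lie in the same or in adjacent cells, so
  their values differ by at most \<open>2 / 2 ^ n\<close>.\<close>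

lemma question_mark_continuous: "continuous_on {0..1} question_mark"
proof (unfold continuous_on_iff, intro ballI allI impI)
  fix x e :: real assume "0 < e"
  obtain n where n: "(1/2) ^ n < e / 2"
    using real_arch_pow_inv[of "e / 2" "1 / 2"] \<open>0 < e\<close> by auto
  define d where "d = Min ((\<lambda>k. farey_point n (Suc k) - farey_point n k) ` {..<2 ^ n})"
  have d: "d > 0" unfolding d_def by (subst Min_gr_iff) (auto simp: farey_gap_pos lessThan_empty_iff)
  have gap: "d \<le> farey_point n (Suc k) - farey_point n k" if "k < 2 ^ n" for k
    unfolding d_def using that by (intro Min_le) auto
  have close: "question_mark z - question_mark y < e"
    if yz: "0 \<le> y" "y \<le> z" "z \<le> 1" "z - y < d" for y z
  proof -
    obtain k where k: "k < 2 ^ n" "farey_point n k \<le> y" "y \<le> farey_point n (Suc k)"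
      using farey_cell[of y] yz by auto
    have "question_mark y \<ge> real k / 2 ^ n"
      using question_mark_mono[OF _ k(2)] k(1) question_mark_farey_point[of k n]
        farey_point_range[of k n] by simp
    moreover have "question_mark z \<le> real (k + 2) / 2 ^ n"
    proof (cases "Suc k < 2 ^ n")
      case True
      then have "z \<le> farey_point n (Suc (Suc k))" using gap[of "Suc k"] k yz by simp
      then show ?thesis
        using question_mark_mono[of z "farey_point n (Suc (Suc k))"] yz True
          question_mark_farey_point[of "Suc (Suc k)" n] by simp
    next
      case False
      have "question_mark z \<le> 1" using question_mark_range[of z] yz by simp
      also have "1 \<le> real (k + 2) / 2 ^ n"
      proof -
        have "2 ^ n \<le> k + 2" using False by simp
        then have "real (2 ^ n) \<le> real (k + 2)" by (simp only: of_nat_le_iff)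
        then show ?thesis by simp
      qed
      finally show ?thesis .
    qed
    ultimately have "question_mark z - question_mark y \<le> 2 / 2 ^ n"
      by (simp add: add_divide_distrib)
    then show ?thesis using n by (simp add: power_one_over)
  qed
  assume x: "x \<in> {0..1}"
  show "\<exists>d>0. \<forall>x'\<in>{0..1}. dist x' x < d \<longrightarrow> dist (question_mark x') (question_mark x) < e"
  proof (intro exI[of _ d] conjI d ballI impI)
    fix y assume y: "y \<in> {0..1}" "dist y x < d"
    show "dist (question_mark y) (question_mark x) < e"
    proof (cases "x \<le> y")
      case True
      then show ?thesis
        using close[of x y] question_mark_mono[of x y] x y by (auto simp: dist_real_def)
    next
      case False
      then show ?thesis
        using close[of y x] question_mark_mono[of y x] x y by (auto simp: dist_real_def)
    qed
  qed
qed

lemma farey_points_dense: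
  assumes "x \<in> {0..1}" "e > 0"
  obtains n k where "k < 2 ^ n" "\<bar>farey_point n k - x\<bar> < e" "farey_point n k \<in> {0..1}"
proof -
  obtain n where n: "1 / (real n + 1) < e"
    using reals_Archimedean[OF \<open>e > 0\<close>] by (auto simp: inverse_eq_divide add.commute)
  obtain k where k: "k < 2 ^ n" "farey_point n k \<le> x" "x \<le> farey_point n (Suc k)"
    using farey_cell[of x n] assms by auto
  have "\<bar>farey_point n k - x\<bar> < e" using k farey_gap_le[OF k(1)] n by linarith
  moreover have "farey_point n k \<in> {0..1}" using k(1) by (intro farey_point_range) simp
  ultimately show thesis using that k by blast
qed

text \<open>Uniqueness: two continuous functions that agree at the Farey points agree on their closure.\<close>

lemma minkowski_eq: "minkowski = restrict question_mark {0..1}"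
  unfolding minkowski_def
proof (rule the_equality)
  show "restrict question_mark {0..1} \<in> {0..1} \<rightarrow>\<^sub>E {0..1} \<and>
    continuous_on {0..1} (restrict question_mark {0..1}) \<and>
    (\<forall>n. \<forall>k < length (farey_seq n).
      restrict question_mark {0..1} (of_rat (farey_seq n ! k)) = real k / 2 ^ n)"
  proof (intro conjI allI impI)
    show "restrict question_mark {0..1} \<in> {0..1} \<rightarrow>\<^sub>E {0..1}"
      using question_mark_range by auto
    show "continuous_on {0..1} (restrict question_mark {0..1})"
      using question_mark_continuous by (rule continuous_on_eq) simp
  next
    fix n k assume "k < length (farey_seq n)"
    then have k: "k \<le> 2 ^ n" by (simp add: length_farey_seq)
    then have "farey_point n k \<in> {0..1}" by (rule farey_point_range)
    then show "restrict question_mark {0..1} (of_rat (farey_seq n ! k)) = real k / 2 ^ n"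
      using question_mark_farey_point[OF k] by (simp add: farey_point_def)
  qed
next
  fix M :: "real \<Rightarrow> real"
  assume M: "M \<in> {0..1} \<rightarrow>\<^sub>E {0..1} \<and> continuous_on {0..1} M \<and>
    (\<forall>n. \<forall>k < length (farey_seq n). M (of_rat (farey_seq n ! k)) = real k / 2 ^ n)"
  define D where "D = {farey_point n k | n k. k < 2 ^ n \<and> farey_point n k \<in> {0..1}}"
  have D: "D \<subseteq> {0..1}" by (auto simp: D_def)
  have clo: "closure D = {0..1}"
  proof
    show "closure D \<subseteq> {0..1}" using D by (simp add: closure_minimal)
    show "{0..1} \<subseteq> closure D"
    proof
      fix x :: real assume x: "x \<in> {0..1}"
      show "x \<in> closure D"
        unfolding closure_approachable
      proof (intro allI impI)
        fix e :: real assume "e > 0"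
        then obtain n k where "k < 2 ^ n" "\<bar>farey_point n k - x\<bar> < e" "farey_point n k \<in> {0..1}"
          using farey_points_dense[OF x] by blast
        then show "\<exists>y\<in>D. dist y x < e" by (auto simp: D_def dist_real_def)
      qed
    qed
  qed
  have agree: "M y - question_mark y = 0" if "y \<in> D" for y
    using that M by (auto simp: D_def question_mark_farey_point length_farey_seq)
      (auto simp: farey_point_def)
  have "M x - question_mark x = 0" if "x \<in> {0..1}" for x
    by (rule continuous_constant_on_closure[where f = "\<lambda>x. M x - question_mark x" and S = D])
      (use M question_mark_continuous that agree in \<open>auto simp: clo intro!: continuous_intros\<close>)
  then show "M = restrict question_mark {0..1}"
    using M by (intro extensionalityI[of _ "{0..1}"]) (auto simp: PiE_iff)
qed

lemma minkowski_farey_point: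
  assumes "k \<le> 2 ^ n"
  shows "minkowski (farey_point n k) = real k / 2 ^ n"
  using question_mark_farey_point[OF assms] farey_point_range[OF assms] by (simp add: minkowski_eq)

lemma minkowski_0_1: "minkowski 0 = 0" "minkowski 1 = 1"
  using minkowski_farey_point[of 0 0] minkowski_farey_point[of 1 0] farey_ends[of 0] by simp_all

lemma minkowski_mono: "0 \<le> x \<Longrightarrow> x \<le> y \<Longrightarrow> y \<le> 1 \<Longrightarrow> minkowski x \<le> minkowski y"
  using question_mark_mono by (simp add: minkowski_eq)

lemma minkowski_range: "0 \<le> x \<Longrightarrow> x \<le> 1 \<Longrightarrow> 0 \<le> minkowski x \<and> minkowski x \<le> 1"
  using question_mark_range[of x] by (simp add: minkowski_eq)

lemma minkowski_continuous: "continuous_on {0..1} minkowski"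
  unfolding minkowski_eq using question_mark_continuous by (rule continuous_on_eq) simp

section \<open>The extended Minkowski measure on the real line\<close>

text \<open>Up to the factor \<open>1 / 3\<close>, the mass to the left of the integer \<open>j\<close>.\<close>

definition left_mass :: "int \<Rightarrow> real" where
  "left_mass j = (\<Sum>\<^sub>\<infinity>k\<in>{..j - 1}. 1 / 2 ^ nat \<bar>k\<bar>)"

lemma left_mass_has_sum:
  "j \<le> 0 \<Longrightarrow> ((\<lambda>k. 1 / 2 ^ nat \<bar>k\<bar>) has_sum (1 / 2 ^ nat (- j) :: real)) {..j - 1}"
proof -
  assume j: "j \<le> 0"
  have "((\<lambda>i. (1/2) ^ nat (- j) * (1/2) ^ Suc i) has_sum ((1/2) ^ nat (- j) * (1::real))) UNIV"
    using power_half_series by (intro has_sum_cmult_right sums_nonneg_imp_has_sum) auto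
  also have "?this \<longleftrightarrow> ((\<lambda>k. 1 / 2 ^ nat \<bar>k\<bar>) has_sum (1/2) ^ nat (- j) * (1::real)) {..j - 1}"
  proof (rule has_sum_reindex_bij_witness[of _ "\<lambda>k. nat (j - 1 - k)" "\<lambda>i. j - 1 - int i"])
    fix i
    have "nat \<bar>j - 1 - int i\<bar> = nat (- j) + Suc i" using j by simp
    then show "1 / 2 ^ nat \<bar>j - 1 - int i\<bar> = (1/2) ^ nat (- j) * (1/2 :: real) ^ Suc i"
      by (simp add: power_add power_one_over)
  qed auto
  finally show ?thesis by (simp add: power_one_over)
qed

lemma left_mass_nonpos: "j \<le> 0 \<Longrightarrow> left_mass j = 1 / 2 ^ nat \<bar>j\<bar>"
  unfolding left_mass_def using infsumI[OF left_mass_has_sum[of j]] by simp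

lemma left_mass_nonneg: "0 \<le> j \<Longrightarrow> left_mass j = 3 - 2 / 2 ^ nat j"
proof -
  have "((\<lambda>k. 1 / 2 ^ nat \<bar>k\<bar>) has_sum (3 - 2 / 2 ^ n :: real)) {..int n - 1}" for n
  proof (induction n)
    case 0
    then show ?case using left_mass_has_sum[of 0] by simp
  next
    case (Suc n)
    have "((\<lambda>k. 1 / 2 ^ nat \<bar>k\<bar>) has_sum (1 / 2 ^ n + (3 - 2 / 2 ^ n) :: real))
      (insert (int n) {..int n - 1})"
      using has_sum_insert[OF _ Suc, of "int n"] by simp
    also have "insert (int n) {..int n - 1} = {..int (Suc n) - 1}" by auto
    finally show ?case by (simp add: field_simps)
  qed
  from infsumI[OF this[of "nat j"]] show "0 \<le> j \<Longrightarrow> left_mass j = 3 - 2 / 2 ^ nat j"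
    by (simp add: left_mass_def)
qed

lemma left_mass_add_1: "left_mass (j + 1) = left_mass j + 1 / 2 ^ nat \<bar>j\<bar>"
proof (cases "0 \<le> j")
  case True
  then show ?thesis by (simp add: left_mass_nonneg nat_add_distrib field_simps)
next
  case False
  define n where "n = nat (- j - 1)"
  have "j = - int (Suc n)" using False by (simp add: n_def)
  then have "nat \<bar>j\<bar> = Suc n" "nat \<bar>j + 1\<bar> = n" by simp_all
  then show ?thesis using False by (simp only: left_mass_nonpos) simp
qed

lemma left_mass_mono: "i \<le> j \<Longrightarrow> left_mass i \<le> left_mass j"
proof (induction j rule: int_ge_induct)
  case (step j)
  have "left_mass j \<le> left_mass (j + 1)" by (simp add: left_mass_add_1)
  then show ?case using step by simp
qed simp

text \<open>The formula for the unit interval starting at \<open>j\<close> also holds at its right end, where the floor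
  jumps; this is what makes the function continuous across the integers.\<close>

lemma extended_minkowski_cell:
  assumes "real_of_int j \<le> q" "q \<le> real_of_int j + 1"
  shows "extended_minkowski q = (left_mass j + minkowski (q - real_of_int j) / 2 ^ nat \<bar>j\<bar>) / 3"
proof (cases "q = real_of_int j + 1")
  case True
  then have "\<lfloor>q\<rfloor> = j + 1" "frac q = 0" by (simp_all add: frac_def)
  then show ?thesis using True
    unfolding extended_minkowski_def left_mass_def[symmetric]
    by (simp add: minkowski_0_1 left_mass_add_1)
next
  case False
  then have "\<lfloor>q\<rfloor> = j" using assms by (simp add: floor_unique)
  then show ?thesis
    unfolding extended_minkowski_def left_mass_def[symmetric] by (simp add: frac_def)
qed

lemma extended_minkowski_int: "extended_minkowski (real_of_int j) = left_mass j / 3"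
  by (simp add: extended_minkowski_cell[of j] minkowski_0_1)

lemma extended_minkowski_mono:
  assumes "q \<le> r"
  shows "extended_minkowski q \<le> extended_minkowski r"
proof -
  define i j where ij: "i = \<lfloor>q\<rfloor>" "j = \<lfloor>r\<rfloor>"
  have q: "real_of_int i \<le> q" "q \<le> real_of_int i + 1"
    and r: "real_of_int j \<le> r" "r \<le> real_of_int j + 1"
    using ij by linarith+
  have "i \<le> j" using assms ij by (simp add: floor_mono)
  show ?thesis
  proof (cases "i = j")
    case True
    have "minkowski (q - real_of_int j) / 2 ^ nat \<bar>j\<bar> \<le> minkowski (r - real_of_int j) / 2 ^ nat \<bar>j\<bar>"
      using q r assms True by (intro divide_right_mono minkowski_mono) auto
    then show ?thesis
      using extended_minkowski_cell[OF q] extended_minkowski_cell[OF r] True by simp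
  next
    case False
    have "extended_minkowski q \<le> left_mass (i + 1) / 3"
      using extended_minkowski_cell[OF q] minkowski_range[of "q - real_of_int i"] q
      by (simp add: left_mass_add_1 divide_right_mono)
    also have "\<dots> \<le> left_mass j / 3" using left_mass_mono[of "i + 1" j] False \<open>i \<le> j\<close> by simp
    also have "\<dots> \<le> extended_minkowski r"
      using extended_minkowski_cell[OF r] minkowski_range[of "r - real_of_int j"] r by simp
    finally show ?thesis .
  qed
qed

lemma extended_minkowski_continuous: "continuous_on UNIV extended_minkowski"
proof -
  have cell: "continuous_on {real_of_int j..real_of_int j + 1} extended_minkowski" for j
  proof (rule continuous_on_eq)
    show "continuous_on {real_of_int j..real_of_int j + 1}
        (\<lambda>q. (left_mass j + minkowski (q - real_of_int j) / 2 ^ nat \<bar>j\<bar>) / 3)"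
      by (intro continuous_intros continuous_on_compose2[OF minkowski_continuous]) auto
  qed (use extended_minkowski_cell[of j] in auto)
  have "continuous (at q) extended_minkowski" for q
  proof (rule continuous_on_interior)
    let ?j = "real_of_int \<lfloor>q\<rfloor>"
    show "continuous_on ({?j - 1..?j} \<union> {?j..?j + 1}) extended_minkowski"
      using cell[of "\<lfloor>q\<rfloor> - 1"] cell[of "\<lfloor>q\<rfloor>"] by (intro continuous_on_closed_Un) auto
    have "{?j - 1..?j} \<union> {?j..?j + 1} = {?j - 1..?j + 1}" by auto
    then show "q \<in> interior ({?j - 1..?j} \<union> {?j..?j + 1})" by (simp, linarith)
  qed
  then show ?thesis by (simp add: continuous_at_imp_continuous_on)
qed

lemma extended_minkowski_at_bot: "(extended_minkowski \<longlongrightarrow> 0) at_bot"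
proof (rule order_tendstoI)
  have pos: "0 < extended_minkowski q" for q
  proof -
    let ?j = "- int (nat \<lceil>\<bar>q\<bar>\<rceil>)"
    have "0 < left_mass ?j / 3" by (simp add: left_mass_nonpos)
    also have "\<dots> \<le> extended_minkowski q"
      unfolding extended_minkowski_int[symmetric] by (rule extended_minkowski_mono) linarith
    finally show ?thesis .
  qed
  fix e :: real
  { assume "e < 0" then show "\<forall>\<^sub>F q in at_bot. e < extended_minkowski q"
      using pos by (meson always_eventually less_trans) }
  assume "0 < e"
  then obtain n where n: "(1/2) ^ n < e" using real_arch_pow_inv[of e "1 / 2"] by auto
  have "extended_minkowski q < e" if "q \<le> real_of_int (- int n)" for q
  proof -
    have "extended_minkowski q \<le> left_mass (- int n) / 3"
      using extended_minkowski_mono[OF that] by (simp only: extended_minkowski_int)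
    also have "\<dots> < e" using n \<open>0 < e\<close> by (simp add: left_mass_nonpos power_one_over)
    finally show ?thesis .
  qed
  then show "\<forall>\<^sub>F q in at_bot. extended_minkowski q < e"
    unfolding eventually_at_bot_linorder by blast
qed

lemma extended_minkowski_at_top: "(extended_minkowski \<longlongrightarrow> 1) at_top"
proof (rule order_tendstoI)
  have below: "extended_minkowski q < 1" for q
  proof -
    let ?j = "int (nat \<lceil>\<bar>q\<bar>\<rceil>)"
    have "extended_minkowski q \<le> left_mass ?j / 3"
      unfolding extended_minkowski_int[symmetric] by (rule extended_minkowski_mono) linarith
    also have "\<dots> < 1" by (simp add: left_mass_nonneg)
    finally show ?thesis .
  qed
  fix e :: real
  { assume "1 < e" then show "\<forall>\<^sub>F q in at_top. extended_minkowski q < e"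
      using below by (meson always_eventually less_trans) }
  assume "e < 1"
  then obtain n where n: "(1/2) ^ n < 1 - e" using real_arch_pow_inv[of "1 - e" "1 / 2"] by auto
  have "e < extended_minkowski q" if "real_of_int (int n) \<le> q" for q
  proof -
    have "e < left_mass (int n) / 3" using n by (simp add: left_mass_nonneg power_one_over field_simps)
    also have "\<dots> \<le> extended_minkowski q"
      using extended_minkowski_mono[OF that] by (simp only: extended_minkowski_int)
    finally show ?thesis .
  qed
  then show "\<forall>\<^sub>F q in at_top. e < extended_minkowski q"
    unfolding eventually_at_top_linorder by blast
qed

definition line_measure :: "real measure" where
  "line_measure = interval_measure extended_minkowski"

lemma extended_minkowski_right_continuous: "continuous (at_right q) extended_minkowski"
  using extended_minkowski_continuous
  by (meson UNIV_I continuous_on_eq_continuous_within continuous_within_subset subset_UNIV)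

lemma real_distribution_line_measure: "real_distribution line_measure"
  unfolding line_measure_def
  by (intro real_distribution_interval_measure extended_minkowski_mono
      extended_minkowski_right_continuous extended_minkowski_at_bot extended_minkowski_at_top)

interpretation line_measure: real_distribution line_measure
  by (rule real_distribution_line_measure)

lemma measure_line_Icc:
  "a \<le> b \<Longrightarrow> measure line_measure {a..b} = extended_minkowski b - extended_minkowski a"
  unfolding line_measure_def measure_def
  by (subst emeasure_interval_measure_Icc)
    (auto simp: extended_minkowski_mono extended_minkowski_continuous)

lemma measure_line_Iic: "measure line_measure {..b} = extended_minkowski b"
proof -
  have "cdf (interval_measure extended_minkowski) = extended_minkowski"
    by (intro cdf_interval_measure extended_minkowski_mono
      extended_minkowski_right_continuous extended_minkowski_at_bot extended_minkowski_at_top)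
  then show ?thesis by (metis cdf_def line_measure_def)
qed

lemma measure_line_singleton: "measure line_measure {a} = 0"
  using measure_line_Icc[of a a] by simp

lemma measure_line_Ico:
  assumes "a \<le> b"
  shows "measure line_measure {a..<b} = extended_minkowski b - extended_minkowski a"
proof -
  have "{a..<b} = {a..b} - {b}" by auto
  then show ?thesis
    using line_measure.finite_measure_Diff[of "{a..b}" "{b}"] assms
    by (simp add: measure_line_Icc measure_line_singleton)
qed

lemma measure_line_Ici: "measure line_measure {a..} = 1 - extended_minkowski a"
proof -
  have "{a..} = (space line_measure - {..a}) \<union> {a}" by auto
  then have "measure line_measure {a..} = measure line_measure (space line_measure - {..a}) + 0"
    using line_measure.finite_measure_Union[of "space line_measure - {..a}" "{a}"]
    by (simp add: measure_line_singleton)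
  then show ?thesis using line_measure.prob_compl[of "{..a}"] by (simp add: measure_line_Iic)
qed

section \<open>The extended Minkowski measure on the projective line\<close>

definition line_vec :: "real \<Rightarrow> real^2" where
  "line_vec t = vector [t, 1]"

lemma line_vec_nth [simp]: "line_vec t $ 1 = t" "line_vec t $ 2 = 1"
  by (simp_all add: line_vec_def)

lemma line_vec_nonzero [simp]: "line_vec t \<noteq> 0"
  by (metis line_vec_nth(2) zero_index zero_neq_one)

lemma proj_of_real_eq: "proj_of_real t = span {line_vec t}"
  by (simp add: proj_of_real_def line_vec_def)

lemma continuous_line_vec: "continuous_on UNIV line_vec"
proof -
  have "line_vec = (\<lambda>t. \<chi> i. if i = 1 then t else 1)"
    by (auto simp: vec_eq_iff forall_2)
  moreover have "continuous_on UNIV (\<lambda>t::real. \<chi> i::2. if i = 1 then t else 1)"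
  proof (rule continuous_on_vec_lambda)
    show "continuous_on UNIV (\<lambda>t::real. if i = 1 then t else 1)" for i :: 2
      by (cases "i = 1") auto
  qed
  ultimately show ?thesis by (simp only:)
qed

lemma span_eq_span_line_vec:
  assumes "v \<noteq> 0"
  shows "span {v} = proj_of_real t \<longleftrightarrow> v $ 2 \<noteq> 0 \<and> v $ 1 / v $ 2 = t"
proof
  assume "span {v} = proj_of_real t"
  then have "v \<in> span {line_vec t}" by (metis proj_of_real_eq insertI1 span_base)
  then obtain c where "v = c *\<^sub>R line_vec t" by (auto simp: span_singleton)
  then show "v $ 2 \<noteq> 0 \<and> v $ 1 / v $ 2 = t" using assms by auto
next
  assume v: "v $ 2 \<noteq> 0 \<and> v $ 1 / v $ 2 = t"
  then have "v = (v $ 2) *\<^sub>R line_vec t" by (auto simp: vec_eq_iff forall_2)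
  then show "span {v} = proj_of_real t"
    using span_image_scale[of "{line_vec t}" "\<lambda>_. v $ 2"] v by (simp add: proj_of_real_eq)
qed

lemma inj_proj_of_real: "inj proj_of_real"
proof
  fix s t assume "proj_of_real s = proj_of_real t"
  then show "s = t" using span_eq_span_line_vec[of "line_vec s" t] by (simp add: proj_of_real_eq)
qed

lemma infinity_notin_range: "proj_infinity \<notin> range proj_of_real"
proof
  assume "proj_infinity \<in> range proj_of_real"
  then obtain t where "span {vector [1, 0]} = proj_of_real t" by (auto simp: proj_infinity_def)
  moreover have "(vector [1, 0] :: real^2) \<noteq> 0" by (simp add: vec_eq_iff forall_2)
  ultimately show False using span_eq_span_line_vec[of "vector [1, 0]" t] by simp
qed

lemma space_proj_borel: "space proj_borel = proj_line"
  unfolding proj_borel_def by (rule space_measure_of) (auto simp: openin_proj_top)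

lemma openin_proj_borel: "openin proj_top U \<Longrightarrow> U \<in> sets proj_borel"
  unfolding proj_borel_def by (subst sets_measure_of) (auto simp: openin_proj_top)

lemma proj_of_real_measurable: "proj_of_real \<in> borel \<rightarrow>\<^sub>M proj_borel"
  unfolding proj_borel_def
proof (rule measurable_measure_of)
  show "{U. openin proj_top U} \<subseteq> Pow proj_line" by (auto simp: openin_proj_top)
  show "proj_of_real \<in> space borel \<rightarrow> proj_line" by (auto simp: proj_line_eq)
  fix U assume "U \<in> {U. openin proj_top U}"
  then have "open {v. v \<noteq> 0 \<and> span {v} \<in> U}" by (simp add: openin_proj_top)
  then have "open (line_vec -` {v. v \<noteq> 0 \<and> span {v} \<in> U})"
    by (rule open_vimage[OF _ continuous_line_vec])
  then show "proj_of_real -` U \<inter> space borel \<in> sets borel"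
    by (simp add: vimage_def proj_of_real_eq)
qed

lemma openin_image_proj_of_real:
  assumes "open S"
  shows "openin proj_top (proj_of_real ` S)"
  unfolding openin_proj_top
proof
  show "proj_of_real ` S \<subseteq> proj_line" by (auto simp: proj_line_eq)
  have nonzero: "v \<noteq> 0" if "v $ 2 \<noteq> 0" for v :: "real^2" using that by auto
  have "{v. v \<noteq> 0 \<and> span {v} \<in> proj_of_real ` S} =
      {v::real^2. v $ 2 \<noteq> 0} \<inter> (\<lambda>v. v $ 1 / v $ 2) -` S"
    using nonzero by (auto simp: image_iff span_eq_span_line_vec)
  moreover have "open {v::real^2. v $ 2 \<noteq> 0}"
    by (intro open_Collect_neq continuous_intros)
  moreover have "open ({v::real^2. v $ 2 \<noteq> 0} \<inter> (\<lambda>v. v $ 1 / v $ 2) -` S)"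
    using assms \<open>open {v::real^2. v $ 2 \<noteq> 0}\<close>
    by (intro continuous_open_preimage) (auto intro!: continuous_intros)
  ultimately show "open {v. v \<noteq> 0 \<and> span {v} \<in> proj_of_real ` S}" by simp
qed

lemma infinity_in_proj_borel: "{proj_infinity} \<in> sets proj_borel"
proof -
  have "{proj_infinity} = space proj_borel - range proj_of_real"
    using infinity_notin_range by (auto simp: space_proj_borel proj_line_eq)
  then show ?thesis
    using openin_proj_borel[OF openin_image_proj_of_real[of UNIV]] by simp
qed

text \<open>The inverse of the chart, extended by an arbitrary value at infinity, is measurable, because
  the preimages of open sets are open up to the point at infinity. The image of \<open>B\<close> is the preimage
  of \<open>B\<close> under this inverse, without the point at infinity.\<close>

lemma image_proj_of_real_borel:
  assumes "B \<in> sets borel"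
  shows "proj_of_real ` B \<in> sets proj_borel"
proof -
  define chart where "chart L = (if L = proj_infinity then 0 else inv_into UNIV proj_of_real L)" for L
  have chart: "chart (proj_of_real t) = t" for t
    using infinity_notin_range by (auto simp: chart_def inj_proj_of_real)
  have pre: "chart -` S \<inter> proj_line = proj_of_real ` S \<union> (if 0 \<in> S then {proj_infinity} else {})"
    for S using infinity_notin_range chart by (auto simp: proj_line_eq chart_def)
  have "chart \<in> proj_borel \<rightarrow>\<^sub>M borel"
  proof (rule borel_measurableI)
    fix S :: "real set" assume "open S"
    then show "chart -` S \<inter> space proj_borel \<in> sets proj_borel"
      using openin_proj_borel[OF openin_image_proj_of_real] infinity_in_proj_borel
      by (simp add: space_proj_borel pre sets.insert_in_sets)
  qed
  then have "chart -` B \<inter> proj_line - {proj_infinity} \<in> sets proj_borel"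
    using assms infinity_in_proj_borel by (metis measurable_sets sets.Diff space_proj_borel)
  moreover have "chart -` B \<inter> proj_line - {proj_infinity} = proj_of_real ` B"
    using infinity_notin_range by (auto simp: pre)
  ultimately show ?thesis by simp
qed

definition minkowski_measure :: "(real^2) set measure" where
  "minkowski_measure = distr line_measure proj_borel proj_of_real"

lemma proj_of_real_measurable_line: "proj_of_real \<in> line_measure \<rightarrow>\<^sub>M proj_borel"
  using proj_of_real_measurable by (simp add: line_measure_def cong: measurable_cong_sets)

lemma extended_minkowski_measure_minkowski_measure: "extended_minkowski_measure minkowski_measure"
proof -
  have meas: "measure minkowski_measure A = measure line_measure (proj_of_real -` A)"
    if "A \<in> sets proj_borel" for A
    using measure_distr[OF proj_of_real_measurable_line that]
    by (simp add: minkowski_measure_def line_measure_def)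
  have "prob_space minkowski_measure"
    unfolding minkowski_measure_def
    by (rule line_measure.prob_space_distr[OF proj_of_real_measurable_line])
  moreover have "measure minkowski_measure {proj_infinity} = 0"
  proof -
    have "proj_of_real -` {proj_infinity} = {}" using infinity_notin_range by auto
    then show ?thesis by (simp add: meas infinity_in_proj_borel)
  qed
  moreover have "measure minkowski_measure (proj_of_real ` {s..<t}) =
      extended_minkowski t - extended_minkowski s" if "s < t" for s t
    using that by (simp add: meas image_proj_of_real_borel inj_vimage_image_eq inj_proj_of_real
        measure_line_Ico)
  ultimately show ?thesis
    by (simp add: extended_minkowski_measure_def minkowski_measure_def space_proj_borel)
qed

section \<open>Ping-pong for the Farey group\<close>

text \<open>The sides of the ideal triangle, which index the generators. The endpoint vectors below are
  oriented such that the real line is traversed in increasing order through the arc.\<close>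

datatype side = Sa | Sb | Sc

lemma UNIV_side: "UNIV = {Sa, Sb, Sc}"
  by (auto intro: side.exhaust)

instance side :: finite
  by standard (simp add: UNIV_side)

primrec gen :: "side \<Rightarrow> real^2^2" where
  "gen Sa = farey_a" | "gen Sb = farey_b" | "gen Sc = farey_c"

primrec left_end :: "side \<Rightarrow> real^2" where
  "left_end Sa = vector [1, 1]" | "left_end Sb = vector [1, 0]" | "left_end Sc = vector [0, 1]"

primrec right_end :: "side \<Rightarrow> real^2" where
  "right_end Sa = vector [1, 0]" | "right_end Sb = vector [0, -1]" | "right_end Sc = vector [1, 1]"

text \<open>The determinant of the matrix with columns \<open>w\<close> and \<open>v\<close>; this order makes it positive for
  vectors that represent fractions \<open>v < w\<close> with positive denominators.\<close>

definition cross :: "real^2 \<Rightarrow> real^2 \<Rightarrow> real" where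
  "cross v w = v $ 2 * w $ 1 - v $ 1 * w $ 2"

text \<open>If \<open>cross v w = 1\<close> and \<open>p = \<alpha> v + \<beta> w\<close>, the value is \<open>\<alpha> * \<beta>\<close>. So it is nonnegative exactly
  when the line through \<open>p\<close> belongs to the closed arc from \<open>v\<close> to \<open>w\<close>, and positive in the interior.\<close>

definition arc_form :: "real^2 \<Rightarrow> real^2 \<Rightarrow> real^2 \<Rightarrow> real" where
  "arc_form v w p = cross v p * cross p w"

definition side_form :: "side \<Rightarrow> real^2 \<Rightarrow> real" where
  "side_form s p = arc_form (left_end s) (right_end s) p"

lemma cross_mult: "cross (A *v v) (A *v w) = det A * cross v w"
  by (simp add: cross_def matrix_vector_mult_def sum_2 det_2 algebra_simps)

lemma arc_form_mult: "det A = 1 \<Longrightarrow> arc_form (A *v v) (A *v w) (A *v p) = arc_form v w p"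
  by (simp add: arc_form_def cross_mult)

lemma side_form_simps:
  "side_form Sa p = p $ 2 * (p $ 1 - p $ 2)"
  "side_form Sb p = - (p $ 1 * p $ 2)"
  "side_form Sc p = p $ 1 * (p $ 2 - p $ 1)"
  by (simp_all add: side_form_def arc_form_def cross_def algebra_simps)

lemma side_form_uminus [simp]: "side_form s (- p) = side_form s p"
  by (cases s) (simp_all add: side_form_simps algebra_simps)

lemma det_gen: "det (gen s) = 1"
  by (cases s) (simp_all add: farey_a_def farey_b_def farey_c_def det_2)

lemma gen_square: "gen s ** gen s = - mat 1"
  by (cases s) (simp_all add: farey_a_def farey_b_def farey_c_def vec_eq_iff forall_2
      matrix_matrix_mult_def sum_2 mat_def)

text \<open>A generator exchanges the arc of its side with the complementary arc.\<close>

lemma side_form_gen: "side_form s (gen s *v p) = - side_form s p"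
  by (cases s) (simp_all add: side_form_simps farey_a_def farey_b_def farey_c_def
      matrix_vector_mult_def sum_2 algebra_simps)

lemma side_form_disjoint:
  assumes "side_form s p > 0" "t \<noteq> s"
  shows "side_form t p < 0"
  using assms by (cases s; cases t) (auto simp: side_form_simps zero_less_mult_iff mult_less_0_iff)

lemma side_form_unique: "side_form s p > 0 \<Longrightarrow> side_form t p > 0 \<Longrightarrow> s = t"
  using side_form_disjoint by force

lemma side_form_cover: "\<exists>t. side_form t p \<ge> 0" "side_form s p \<le> 0 \<Longrightarrow> \<exists>t. t \<noteq> s \<and> side_form t p \<ge> 0"
proof -
  have *: "\<exists>t. t \<noteq> s \<and> side_form t p \<ge> 0" if "side_form s p \<le> 0" for s
  proof (rule ccontr)
    assume "\<not> ?thesis"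
    then have "side_form t p < 0" if "t \<noteq> s" for t using that by (meson not_le)
    from this[of Sa] this[of Sb] this[of Sc] show False
      using that
      by (cases s) (auto simp: side_form_simps zero_less_mult_iff mult_less_0_iff mult_le_0_iff
          zero_le_mult_iff)
  qed
  then show "side_form s p \<le> 0 \<Longrightarrow> \<exists>t. t \<noteq> s \<and> side_form t p \<ge> 0" .
  show "\<exists>t. side_form t p \<ge> 0" using * by (meson nle_le)
qed

text \<open>Two sides leave at least one further side, and a point interior to its arc is outside the arcs
  of both.\<close>

lemma point_outside_two_arcs:
  obtains p where "side_form s p < 0" "side_form t p < 0"
proof -
  obtain r where r: "r \<noteq> s" "r \<noteq> t"
    by (cases s; cases t; metis side.distinct)
  have "\<exists>p. side_form r p > 0"
  proof (cases r)
    case Sa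
    then show ?thesis by (intro exI[of _ "vector [2, 1]"]) (simp add: side_form_simps)
  next
    case Sb
    then show ?thesis by (intro exI[of _ "vector [-1, 1]"]) (simp add: side_form_simps)
  next
    case Sc
    then show ?thesis by (intro exI[of _ "vector [1, 2]"]) (simp add: side_form_simps)
  qed
  then show thesis using that side_form_disjoint r by metis
qed

primrec word_mat :: "side list \<Rightarrow> real^2^2" where
  "word_mat [] = mat 1"
| "word_mat (s # ss) = gen s ** word_mat ss"

lemma word_mat_append: "word_mat (u @ w) = word_mat u ** word_mat w"
  by (induction u) (simp_all add: matrix_mul_assoc)

lemma det_word_mat: "det (word_mat ss) = 1"
  by (induction ss) (simp_all add: det_mul det_gen)

text \<open>Each letter maps the complement of its own arc into that arc. As neighbouring letters differ,
  the arc reached by one letter lies in the complement needed by the next.\<close>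

lemma ping_pong:
  assumes "distinct_adj ss" "ss \<noteq> []" "side_form (last ss) p < 0"
  shows "side_form (hd ss) (word_mat ss *v p) > 0"
  using assms
proof (induction ss)
  case (Cons s ss)
  have "side_form s (word_mat ss *v p) < 0"
  proof (cases ss)
    case Nil
    then show ?thesis using Cons.prems by simp
  next
    case (Cons t ts)
    then have "side_form t (word_mat ss *v p) > 0" "s \<noteq> t" using Cons.IH Cons.prems by auto
    then show ?thesis by (intro side_form_disjoint)
  qed
  then show ?case by (simp add: side_form_gen matrix_vector_mul_assoc[symmetric])
qed simp

lemma psl_eq_iff: "psl A = psl B \<longleftrightarrow> A = B \<or> A = - B"
  by (auto simp: psl_eq doubleton_eq_iff)

lemma psl_cancel_gen: "psl (gen s ** A) = psl (gen s ** B) \<Longrightarrow> psl A = psl B"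
proof -
  assume "psl (gen s ** A) = psl (gen s ** B)"
  then have "gen s ** (gen s ** A) = gen s ** (gen s ** B) \<or>
      gen s ** (gen s ** A) = - (gen s ** (gen s ** B))"
    by (metis psl_eq_iff matrix_mul_uminus(2))
  then show ?thesis
    by (auto simp: psl_eq_iff matrix_mul_assoc gen_square matrix_mul_uminus)
qed

lemma side_form_psl: "psl A = psl B \<Longrightarrow> side_form s (A *v p) = side_form s (B *v p)"
proof -
  have "(- B) *v p = - (B *v p)" by (simp add: vec_eq_iff matrix_vector_mult_def sum_negf)
  then show "psl A = psl B \<Longrightarrow> ?thesis" by (auto simp: psl_eq_iff)
qed

lemma nonempty_reduced_word_not_one:
  assumes "distinct_adj ss" "ss \<noteq> []"
  shows "psl (word_mat ss) \<noteq> psl (mat 1)"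
proof
  assume eq: "psl (word_mat ss) = psl (mat 1)"
  obtain p where "side_form (hd ss) p < 0" "side_form (last ss) p < 0" by (rule point_outside_two_arcs)
  then show False using ping_pong[OF assms, of p] side_form_psl[OF eq, of "hd ss" p] by simp
qed

text \<open>A point outside the arcs of both last letters is moved into the arcs of both first letters.
  The images coincide and the interiors of the arcs are disjoint, so the first letters agree and
  can be cancelled.\<close>

lemma reduced_word_unique:
  assumes "distinct_adj u" "distinct_adj w" "psl (word_mat u) = psl (word_mat w)"
  shows "u = w"
  using assms
proof (induction u arbitrary: w)
  case Nil
  then show ?case using nonempty_reduced_word_not_one[of w] by force
next
  case (Cons s u)
  have w: "w \<noteq> []" using nonempty_reduced_word_not_one[of "s # u"] Cons.prems by force
  obtain p where p: "side_form (last (s # u)) p < 0" "side_form (last w) p < 0"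
    by (rule point_outside_two_arcs)
  have "side_form s (word_mat (s # u) *v p) > 0" using ping_pong[OF Cons.prems(1) _ p(1)] by simp
  moreover have "side_form (hd w) (word_mat (s # u) *v p) > 0"
    using ping_pong[OF Cons.prems(2) w p(2)] side_form_psl[OF Cons.prems(3)] by simp
  ultimately have "s = hd w" by (rule side_form_unique)
  then obtain w' where w': "w = s # w'" using w by (cases w) auto
  then have "psl (gen s ** word_mat u) = psl (gen s ** word_mat w')" using Cons.prems(3) by simp
  then have "psl (word_mat u) = psl (word_mat w')" by (rule psl_cancel_gen)
  moreover have "distinct_adj u" "distinct_adj w'"
    using Cons.prems w' by (auto dest: distinct_adj_ConsD)
  ultimately have "u = w'" by (intro Cons.IH)
  then show ?case by (simp add: w')
qed

lemma psl_mult_cong: "psl A = psl B \<Longrightarrow> psl (C ** A) = psl (C ** B)"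
  by (auto simp: psl_eq_iff matrix_mul_uminus)

lemma reduce_word:
  obtains r where "distinct_adj r" "length r \<le> length ss" "psl (word_mat r) = psl (word_mat ss)"
proof -
  have "\<exists>r. distinct_adj r \<and> length r \<le> length ss \<and> psl (word_mat r) = psl (word_mat ss)"
  proof (induction ss)
    case (Cons s ss)
    then obtain r where r: "distinct_adj r" "length r \<le> length ss" "psl (word_mat r) = psl (word_mat ss)"
      by blast
    then have eq: "psl (word_mat (s # r)) = psl (word_mat (s # ss))"
      using psl_mult_cong[OF r(3), of "gen s"] by simp
    show ?case
    proof (cases "r \<noteq> [] \<and> hd r = s")
      case True
      then obtain r' where r': "r = s # r'" by (cases r) auto
      have "word_mat (s # r) = - word_mat r'"
        by (simp add: r' matrix_mul_assoc gen_square matrix_mul_uminus)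
      then have "psl (word_mat r') = psl (word_mat (s # ss))"
        using eq by (metis psl_eq_iff)
      then show ?thesis using r r' by (intro exI[of _ r']) (auto dest: distinct_adj_ConsD)
    next
      case False
      then show ?thesis using r eq by (intro exI[of _ "s # r"]) (auto simp: distinct_adj_Cons)
    qed
  qed auto
  then show thesis using that by blast
qed

lemma farey_gens_eq: "farey_gens = range (\<lambda>s. psl (gen s))"
  by (auto simp: farey_gens_def UNIV_side)

lemma mult_farey: "psl A \<otimes>\<^bsub>farey_group\<^esub> psl B = psl (A ** B)"
  by (simp add: farey_group_def subgroup_generated_def mult_PSL)

lemma one_PSL2Z: "\<one>\<^bsub>PSL2Z\<^esub> = psl (mat 1)"
  by (simp add: PSL2Z_def FactGroup_def psl_eq sign_group_def)

lemma one_farey: "\<one>\<^bsub>farey_group\<^esub> = psl (mat 1)"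
  by (simp add: farey_group_def one_PSL2Z)

lemma foldr_farey:
  "foldr (mult farey_group) (map (\<lambda>s. psl (gen s)) ss) \<one>\<^bsub>farey_group\<^esub> = psl (word_mat ss)"
  by (induction ss) (simp_all add: one_farey mult_farey)

lemma carrier_farey_group: "carrier farey_group = range (\<lambda>ss. psl (word_mat ss))"
proof -
  have "carrier farey_group = generate PSL2Z farey_gens"
    using farey_gens_subset by (simp add: farey_group_def carrier_subgroup_generated inf_absorb2)
  moreover have "generate PSL2Z farey_gens = range (\<lambda>ss. psl (word_mat ss))"
  proof (intro equalityI subsetI)
    fix g assume "g \<in> generate PSL2Z farey_gens"
    then show "g \<in> range (\<lambda>ss. psl (word_mat ss))"
    proof induction
      case one
      then show ?case by (intro image_eqI[of _ _ "[]"]) (simp_all add: one_PSL2Z)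
    next
      case (incl h)
      then obtain s where "h = psl (word_mat [s])" by (auto simp: farey_gens_eq)
      then show ?case by blast
    next
      case (inv h)
      then obtain s where s: "h = psl (gen s)" by (auto simp: farey_gens_eq)
      have "h \<otimes>\<^bsub>PSL2Z\<^esub> h = \<one>\<^bsub>PSL2Z\<^esub>"
        by (simp add: s mult_PSL one_PSL2Z gen_square psl_eq_iff)
      then have "inv\<^bsub>PSL2Z\<^esub> h = h"
        using group.inv_equality[OF group_PSL2Z] inv farey_gens_subset by blast
      then have "inv\<^bsub>PSL2Z\<^esub> h = psl (word_mat [s])" by (simp add: s)
      then show ?case by blast
    next
      case (eng g h)
      then obtain u w where "g = psl (word_mat u)" "h = psl (word_mat w)" by blast
      then have "g \<otimes>\<^bsub>PSL2Z\<^esub> h = psl (word_mat (u @ w))" by (simp add: mult_PSL word_mat_append)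
      then show ?case by blast
    qed
  next
    fix g assume "g \<in> range (\<lambda>ss. psl (word_mat ss))"
    then obtain ss where "g = psl (word_mat ss)" by blast
    moreover have "psl (word_mat ss) \<in> generate PSL2Z farey_gens"
    proof (induction ss)
      case Nil
      then show ?case using generate.one[of PSL2Z farey_gens] by (simp add: one_PSL2Z)
    next
      case (Cons s ss)
      have "psl (gen s) \<in> generate PSL2Z farey_gens"
        by (rule generate.incl) (auto simp: farey_gens_eq)
      from generate.eng[OF this Cons] show ?case by (simp add: mult_PSL)
    qed
    ultimately show "g \<in> generate PSL2Z farey_gens" by simp
  qed
  ultimately show ?thesis by simp
qed

text \<open>Reduction shortens words and the reduced word of a group element is unique, so reduced words
  are the shortest ones.\<close>

lemma word_norm_reduced:
  assumes "distinct_adj r"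
  shows "word_norm farey_group farey_gens (psl (word_mat r)) = length r"
proof (cases "r = []")
  case True
  then show ?thesis by (simp add: word_norm_def one_farey)
next
  case False
  have "(LEAST n. \<exists>ss. length ss = n \<and> set ss \<subseteq> farey_gens \<and>
      psl (word_mat r) = foldr (mult farey_group) ss \<one>\<^bsub>farey_group\<^esub>) = length r"
  proof (rule Least_equality)
    show "\<exists>ss. length ss = length r \<and> set ss \<subseteq> farey_gens \<and>
        psl (word_mat r) = foldr (mult farey_group) ss \<one>\<^bsub>farey_group\<^esub>"
      by (intro exI[of _ "map (\<lambda>s. psl (gen s)) r"]) (auto simp: foldr_farey farey_gens_eq)
  next
    fix n
    assume "\<exists>ss. length ss = n \<and> set ss \<subseteq> farey_gens \<and>
        psl (word_mat r) = foldr (mult farey_group) ss \<one>\<^bsub>farey_group\<^esub>"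
    then obtain ss where ss: "length ss = n" "set ss \<subseteq> farey_gens"
        "psl (word_mat r) = foldr (mult farey_group) ss \<one>\<^bsub>farey_group\<^esub>" by blast
    from ss(2) have "ss \<in> lists (range (\<lambda>s. psl (gen s)))" by (auto simp: farey_gens_eq)
    then obtain ts where ts: "ss = map (\<lambda>s. psl (gen s)) ts" by (auto simp: lists_image)
    obtain r' where r': "distinct_adj r'" "length r' \<le> length ts" "psl (word_mat r') = psl (word_mat ts)"
      by (rule reduce_word)
    have "r = r'"
      using ss(3) r' assms by (intro reduced_word_unique) (simp_all add: ts foldr_farey)
    then show "length r \<le> n" using r' ss(1) ts by simp
  qed
  then show ?thesis
    using nonempty_reduced_word_not_one[OF assms False] by (simp add: word_norm_def one_farey)
qed

section \<open>Spheres and reduced words\<close>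

definition reduced_words :: "nat \<Rightarrow> side list set" where
  "reduced_words n = {ss. length ss = n \<and> distinct_adj ss}"

lemma bij_reduced_words_sphere:
  "bij_betw (\<lambda>ss. psl (word_mat ss)) (reduced_words n) (farey_sphere n)"
proof (rule bij_betw_imageI)
  show "inj_on (\<lambda>ss. psl (word_mat ss)) (reduced_words n)"
    using reduced_word_unique by (auto simp: inj_on_def reduced_words_def)
  show "(\<lambda>ss. psl (word_mat ss)) ` reduced_words n = farey_sphere n"
  proof (intro equalityI subsetI)
    fix g assume "g \<in> farey_sphere n"
    then obtain ss where ss: "g = psl (word_mat ss)" "word_norm farey_group farey_gens g = n"
      by (auto simp: farey_sphere_def carrier_farey_group)
    obtain r where "distinct_adj r" "psl (word_mat r) = psl (word_mat ss)" by (rule reduce_word)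
    then show "g \<in> (\<lambda>ss. psl (word_mat ss)) ` reduced_words n"
      using ss word_norm_reduced[of r] by (auto simp: reduced_words_def)
  qed (auto simp: farey_sphere_def carrier_farey_group reduced_words_def word_norm_reduced)
qed

lemma proj_act_span: "p \<noteq> 0 \<Longrightarrow> proj_act (psl A) (span {p}) = span {A *v p}"
  using linear_span_image[OF matrix_vector_mul_linear[of A], of "{p}"]
  by (subst proj_act_psl) (auto simp: proj_line_def)

lemma sphere_sum_eq:
  "p \<noteq> 0 \<Longrightarrow> sphere_sum n f (span {p}) = (\<Sum>ss\<in>reduced_words n. f (span {word_mat ss *v p}))"
  unfolding sphere_sum_def
  by (subst sum.reindex_bij_betw[OF bij_reduced_words_sphere, symmetric]) (simp add: proj_act_span)

lemma card_sphere: "card (farey_sphere n) = card (reduced_words n)"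
  using bij_betw_same_card[OF bij_reduced_words_sphere] by simp

lemma finite_reduced_words: "finite (reduced_words n)"
  using finite_lists_length_eq[of "UNIV :: side set" n]
  by (rule finite_subset[rotated]) (auto simp: reduced_words_def)

definition extensions :: "side \<Rightarrow> nat \<Rightarrow> side list set" where
  "extensions s k = {w. length w = k \<and> distinct_adj (s # w)}"

lemma finite_extensions: "finite (extensions s k)"
  using finite_lists_length_eq[of "UNIV :: side set" k]
  by (rule finite_subset[rotated]) (auto simp: extensions_def)

lemma card_extensions: "card (extensions s k) = 2 ^ k"
proof (induction k arbitrary: s)
  case 0
  have "extensions s 0 = {[]}" by (auto simp: extensions_def)
  then show ?case by simp
next
  case (Suc k)
  have "extensions s (Suc k) = (\<Union>t\<in>UNIV - {s}. (#) t ` extensions t k)"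
    by (auto simp: extensions_def length_Suc_conv)
  also have "card \<dots> = (\<Sum>t\<in>UNIV - {s}. card ((#) t ` extensions t k))"
    by (rule card_UN_disjoint) (auto simp: finite_extensions)
  also have "\<dots> = (\<Sum>t\<in>UNIV - {s}. 2 ^ k)" by (simp add: card_image Suc)
  moreover have "card (UNIV - {s}) = 2" by (cases s) (simp_all add: UNIV_side insert_Diff_if)
  ultimately show ?case by simp
qed

lemma card_reduced_words: "card (reduced_words (Suc n)) = 3 * 2 ^ n"
proof -
  have "reduced_words (Suc n) = (\<Union>s. (#) s ` extensions s n)"
    by (auto simp: extensions_def reduced_words_def length_Suc_conv)
  also have "card \<dots> = (\<Sum>s\<in>UNIV. card ((#) s ` extensions s n))"
    by (rule card_UN_disjoint) (auto simp: finite_extensions)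
  also have "\<dots> = (\<Sum>s\<in>(UNIV :: side set). 2 ^ n)" by (simp add: card_image card_extensions)
  finally show ?thesis by (simp add: UNIV_side)
qed

lemma sum_reduced_words_split:
  assumes "m > 0"
  shows "(\<Sum>ss\<in>reduced_words (m + k). g ss) =
    (\<Sum>u\<in>reduced_words m. \<Sum>w\<in>extensions (last u) k. g (u @ w))"
proof -
  have "(\<Sum>u\<in>reduced_words m. \<Sum>w\<in>extensions (last u) k. g (u @ w)) =
      (\<Sum>(u, w)\<in>Sigma (reduced_words m) (\<lambda>u. extensions (last u) k). g (u @ w))"
    by (rule sum.Sigma) (auto simp: finite_reduced_words finite_extensions)
  also have "\<dots> = (\<Sum>ss\<in>reduced_words (m + k). g ss)"
  proof (rule sum.reindex_bij_witness[of _ "\<lambda>ss. (take m ss, drop m ss)" "\<lambda>(u, w). u @ w"])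
    fix ss assume "ss \<in> reduced_words (m + k)"
    then have ss: "length ss = m + k" "distinct_adj (take m ss @ drop m ss)"
      by (auto simp: reduced_words_def)
    moreover have "take m ss \<noteq> []" using ss assms by auto
    ultimately show "(take m ss, drop m ss) \<in> Sigma (reduced_words m) (\<lambda>u. extensions (last u) k)"
      unfolding distinct_adj_append_iff
      by (auto simp: reduced_words_def extensions_def distinct_adj_Cons)
  next
    fix a assume "a \<in> Sigma (reduced_words m) (\<lambda>u. extensions (last u) k)"
    then show "(case a of (u, w) \<Rightarrow> u @ w) \<in> reduced_words (m + k)"
      by (auto simp: reduced_words_def extensions_def distinct_adj_Cons distinct_adj_append_iff)
  qed (auto simp: reduced_words_def)
  finally show ?thesis by simp
qed

text \<open>If the image of \<open>p\<close> under the word \<open>a # v\<close> is interior to the arc of a side other than \<open>a\<close>, then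
  it is outside the arc of \<open>a\<close>, so the image under \<open>v\<close> is interior to the arc of \<open>a\<close>. By induction,
  \<open>p\<close> is interior to the arc of the last letter, which determines that letter; then the image
  under it determines the letter before, and so on.\<close>

lemma exceptional_word_unique:
  assumes "length u = length w" "distinct_adj (s # u)" "distinct_adj (t # w)"
    "side_form s (word_mat u *v p) > 0" "side_form t (word_mat w *v p) > 0"
  shows "s = t \<and> u = w"
  using assms
proof (induction u w arbitrary: s t rule: list_induct2)
  case Nil
  then show ?case using side_form_unique by auto
next
  case (Cons a u b w)
  have tail: "side_form c (word_mat v *v p) > 0"
    if "r \<noteq> c" "side_form r (word_mat (c # v) *v p) > 0" for r c v
    using side_form_disjoint[OF that(2), of c] that(1)
    by (simp add: side_form_gen matrix_vector_mul_assoc[symmetric])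
  have "a = b \<and> u = w"
    using Cons.prems tail[of s a u] tail[of t b w] by (intro Cons.IH) auto
  then show ?case using Cons.prems side_form_unique by blast
qed

section \<open>Farey arcs\<close>

text \<open>Arcs are described by vectors that span their endpoints. The last rule is needed since the
  matrices reproduce these vectors only up to a common sign.\<close>

inductive farey_arc :: "nat \<Rightarrow> real^2 \<Rightarrow> real^2 \<Rightarrow> bool" where
  side: "farey_arc 0 (left_end s) (right_end s)"
| left: "farey_arc n v w \<Longrightarrow> farey_arc (Suc n) v (v + w)"
| right: "farey_arc n v w \<Longrightarrow> farey_arc (Suc n) (v + w) w"
| neg: "farey_arc n v w \<Longrightarrow> farey_arc n (- v) (- w)"

text \<open>The arc of \<open>t\<close> is the union of the images under \<open>t\<close> of the other two arcs, and they meet at the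
  mediant of its endpoints.\<close>

lemma gen_halves:
  assumes "s \<noteq> t"
  obtains "gen t *v left_end s = left_end t" "gen t *v right_end s = left_end t + right_end t"
  | "gen t *v left_end s = left_end t + right_end t" "gen t *v right_end s = right_end t"
  | "gen t *v left_end s = - left_end t" "gen t *v right_end s = - (left_end t + right_end t)"
  | "gen t *v left_end s = - (left_end t + right_end t)" "gen t *v right_end s = - right_end t"
  using assms
  by (cases s; cases t) (simp_all add: farey_a_def farey_b_def farey_c_def vec_eq_iff forall_2
      matrix_vector_mult_def sum_2)

lemma farey_arc_word:
  "distinct_adj (u @ [s]) \<Longrightarrow>
    farey_arc (length u) (word_mat u *v left_end s) (word_mat u *v right_end s)"
proof (induction u arbitrary: s rule: rev_induct)
  case Nil
  then show ?case by (simp add: farey_arc.side)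
next
  case (snoc t u)
  let ?l = "word_mat u *v left_end t" and ?r = "word_mat u *v right_end t"
  have neg: "A *v (- p) = - (A *v p)" for A :: "real^2^2" and p
    by (simp add: vec_eq_iff matrix_vector_mult_def sum_negf)
  have "s \<noteq> t" and "distinct_adj (u @ [t])"
    using snoc.prems by (auto simp: distinct_adj_append_iff)
  then have arc: "farey_arc (length u) ?l ?r" using snoc.IH by blast
  have word: "word_mat (u @ [t]) *v p = word_mat u *v (gen t *v p)" for p
    by (simp add: word_mat_append matrix_vector_mul_assoc)
  show ?case
    unfolding word
    by (rule gen_halves[OF \<open>s \<noteq> t\<close>])
      (use farey_arc.left[OF arc] farey_arc.right[OF arc]
          farey_arc.neg[OF farey_arc.left[OF arc]] farey_arc.neg[OF farey_arc.right[OF arc]] in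
        \<open>simp_all add: matrix_vector_right_distrib matrix_vector_mult_diff_distrib neg\<close>)
qed

lemma cross_simps:
  "cross (u + v) w = cross u w + cross v w" "cross u (v + w) = cross u v + cross u w"
  "cross (- v) w = - cross v w" "cross v (- w) = - cross v w" "cross v v = 0"
  by (simp_all add: cross_def algebra_simps)

lemma arc_form_uminus [simp]:
  "arc_form v w (- p) = arc_form v w p" "arc_form (- v) (- w) p = arc_form v w p"
  by (simp_all add: arc_form_def cross_simps(3,4))

text \<open>As the inner product of \<open>v\<close> and \<open>w\<close> stays nonnegative, the squared length of \<open>v + w\<close> is at
  least the sum of those of \<open>v\<close> and \<open>w\<close>; so halving adds at least 1 to the sum of the squared
  lengths of the two endpoint vectors.\<close>

lemma farey_arc_geometry:
  assumes "farey_arc n v w"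
  shows "cross v w = 1 \<and> v \<bullet> w \<ge> 0 \<and> v \<bullet> v \<ge> 1 \<and> w \<bullet> w \<ge> 1 \<and> v \<bullet> v + w \<bullet> w \<ge> real n + 1"
  using assms
proof induction
  case (side s)
  then show ?case by (cases s) (simp_all add: cross_def inner_vec_def sum_2)
qed (auto simp: cross_simps inner_add_left inner_add_right inner_commute)

lemma arc_coordinates: "cross v w *\<^sub>R p = cross p w *\<^sub>R v + cross v p *\<^sub>R w"
  by (simp add: vec_eq_iff forall_2 cross_def algebra_simps)

lemma lagrange_identity: "(v \<bullet> p)\<^sup>2 + (cross v p)\<^sup>2 = (v \<bullet> v) * (p \<bullet> p)" for v p :: "real^2"
  by (simp add: cross_def inner_vec_def sum_2 power2_eq_square algebra_simps)

text \<open>Write \<open>q = a v + b w\<close> with nonnegative coefficients. The sine of the angle between \<open>v\<close> and \<open>q\<close> is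
  \<open>b / (|v| |q|)\<close>, and \<open>|q| \<ge> b |w|\<close>; so it is at most \<open>1 / (|v| |w|)\<close>. As the angle is not
  obtuse, the distance of the unit vectors is at most \<open>sqrt 2\<close> times the sine.\<close>

lemma farey_arc_close:
  assumes "farey_arc n v w" "n > 0" "p \<noteq> 0" "arc_form v w p \<ge> 0"
  obtains q where "q = p \<or> q = - p" "(dist (sgn q) (sgn v))\<^sup>2 \<le> 2 / real n"
proof -
  note geo = farey_arc_geometry[OF assms(1)]
  have "\<exists>q. (q = p \<or> q = - p) \<and> cross v q \<ge> 0 \<and> cross q w \<ge> 0"
    using assms(4) cross_simps(3,4)
    by (auto simp: arc_form_def zero_le_mult_iff intro: exI[of _ p] exI[of _ "- p"])
  then obtain q where q: "q = p \<or> q = - p" "cross v q \<ge> 0" "cross q w \<ge> 0" by blast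
  define a b where "a = cross q w" and "b = cross v q"
  have qab: "q = a *\<^sub>R v + b *\<^sub>R w" using arc_coordinates[of v w q] geo by (simp add: a_def b_def)
  have ab: "a \<ge> 0" "b \<ge> 0" using q by (simp_all add: a_def b_def)
  have vq: "v \<bullet> q \<ge> 0" using ab geo by (simp add: qab inner_add_right)
  have "q \<bullet> q = a\<^sup>2 * (v \<bullet> v) + 2 * (a * b * (v \<bullet> w)) + b\<^sup>2 * (w \<bullet> w)"
    by (simp add: qab inner_add_left inner_add_right inner_commute power2_eq_square algebra_simps)
  then have qq: "q \<bullet> q \<ge> b\<^sup>2 * (w \<bullet> w)" using ab geo by simp
  have pos: "v \<bullet> v > 0" "q \<bullet> q > 0" "v \<noteq> 0" "q \<noteq> 0" using geo assms(3) q(1) by auto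
  define c where "c = sgn q \<bullet> sgn v"
  have "c = (v \<bullet> q) / (norm v * norm q)"
    by (simp add: c_def sgn_div_norm inner_commute divide_inverse)
  then have c: "c \<ge> 0" "c\<^sup>2 = (v \<bullet> q)\<^sup>2 / ((v \<bullet> v) * (q \<bullet> q))"
    using vq by (simp_all add: power_divide power_mult_distrib power2_norm_eq_inner)
  have "(v \<bullet> v - 1) * (w \<bullet> w - 1) \<ge> 0" using geo by simp
  then have vw: "(v \<bullet> v) * (w \<bullet> w) \<ge> real n" using geo by (simp add: algebra_simps)
  have "1 - c\<^sup>2 = b\<^sup>2 / ((v \<bullet> v) * (q \<bullet> q))"
    using lagrange_identity[of v q] pos by (simp add: c(2) b_def field_simps)
  also have "\<dots> \<le> 1 / real n"
  proof -
    have "b\<^sup>2 * real n \<le> b\<^sup>2 * ((v \<bullet> v) * (w \<bullet> w))" using vw by (intro mult_left_mono) auto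
    also have "\<dots> \<le> (v \<bullet> v) * (q \<bullet> q)"
      using mult_left_mono[OF qq, of "v \<bullet> v"] pos(1) by (simp add: mult_ac)
    finally show ?thesis using pos assms(2) by (simp add: field_simps)
  qed
  finally have c2: "1 - c\<^sup>2 \<le> 1 / real n" .
  have "c \<le> 1"
    using norm_cauchy_schwarz[of "sgn q" "sgn v"] pos by (simp add: c_def norm_sgn)
  then have "c\<^sup>2 \<le> c" using c(1) by (simp add: power2_eq_square mult_left_le)
  have "(dist (sgn q) (sgn v))\<^sup>2 = 2 - 2 * c"
    using pos by (simp add: dist_norm power2_norm_eq_inner inner_diff_left inner_diff_right c_def
        inner_commute) (simp add: power2_norm_eq_inner[symmetric] norm_sgn)
  also have "\<dots> \<le> 2 / real n" using c2 \<open>c\<^sup>2 \<le> c\<close> by simp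
  finally show thesis using that q(1) by blast
qed

lemma span_scale: "c \<noteq> 0 \<Longrightarrow> span {c *\<^sub>R v} = span {v}" for v :: "real^2"
  using span_image_scale[of "{v}" "\<lambda>_. c"] by simp

lemma span_sgn: "span {sgn v} = span {v}" for v :: "real^2"
  using span_scale[of "inverse (norm v)" v] by (cases "v = 0") (simp_all add: sgn_div_norm)

text \<open>Continuous functions on the projective line are studied through the functions that they induce
  on the unit circle, which is compact.\<close>

lemma continuous_on_lift:
  assumes "continuous_map proj_top euclideanreal f"
  shows "continuous_on (- {0}) (\<lambda>v. f (span {v}))"
  using continuous_map_compose[OF quotient_imp_continuous_map[OF quotient_map_proj_line] assms]
  by (simp add: o_def)

lemma continuous_map_proj_bounded:
  assumes "continuous_map proj_top euclideanreal f"
  obtains B where "\<And>v. v \<noteq> 0 \<Longrightarrow> \<bar>f (span {v})\<bar> \<le> B"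
proof -
  have "continuous_on (sphere 0 1) (\<lambda>v. f (span {v}))"
    by (rule continuous_on_subset[OF continuous_on_lift[OF assms]]) auto
  then have "bounded ((\<lambda>v. f (span {v})) ` sphere 0 1)"
    by (intro compact_imp_bounded compact_continuous_image) auto
  then obtain B where "\<forall>y\<in>(\<lambda>v. f (span {v})) ` sphere 0 1. norm y \<le> B"
    unfolding bounded_iff by blast
  then have B: "\<bar>f (span {v})\<bar> \<le> B" if "v \<in> sphere 0 1" for v using that by simp
  have "\<bar>f (span {v})\<bar> \<le> B" if "v \<noteq> 0" for v
    using B[of "sgn v"] that by (simp add: span_sgn norm_sgn)
  then show thesis using that by blast
qed

lemma oscillation_on_farey_arcs:
  assumes f: "continuous_map proj_top euclideanreal f" and "e > 0"
  obtains N where "\<And>n v w p. \<lbrakk>n \<ge> N; farey_arc n v w; p \<noteq> 0; arc_form v w p \<ge> 0\<rbrakk> \<Longrightarrow>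
    \<bar>f (span {p}) - f (span {v})\<bar> \<le> e"
proof -
  have "continuous_on (sphere 0 1) (\<lambda>v. f (span {v}))"
    by (rule continuous_on_subset[OF continuous_on_lift[OF f]]) auto
  then have "uniformly_continuous_on (sphere 0 1) (\<lambda>v. f (span {v}))"
    by (intro compact_uniformly_continuous) auto
  then obtain d where d: "d > 0" "\<And>x y. \<lbrakk>x \<in> sphere 0 1; y \<in> sphere 0 1; dist x y < d\<rbrakk> \<Longrightarrow>
      dist (f (span {x})) (f (span {y})) < e"
    unfolding uniformly_continuous_on_def using \<open>e > 0\<close> by metis
  obtain N where N: "2 / d\<^sup>2 < real N" using reals_Archimedean2 by blast
  moreover have "0 < 2 / d\<^sup>2" using d by simp
  ultimately have "N > 0" by (metis of_nat_0_less_iff order.strict_trans)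
  have "\<bar>f (span {p}) - f (span {v})\<bar> \<le> e"
    if n: "n \<ge> N" and arc: "farey_arc n v w" "p \<noteq> 0" "arc_form v w p \<ge> 0" for n v w p
  proof -
    obtain q where q: "q = p \<or> q = - p" "(dist (sgn q) (sgn v))\<^sup>2 \<le> 2 / real n"
      using farey_arc_close[OF arc(1) _ arc(2,3)] n \<open>N > 0\<close> by (metis less_le_trans)
    have "2 / real n \<le> 2 / real N" using n \<open>N > 0\<close> by (simp add: frac_le)
    also have "\<dots> < d\<^sup>2" using N d \<open>N > 0\<close> by (simp add: field_simps)
    finally have "(dist (sgn q) (sgn v))\<^sup>2 < d\<^sup>2" using q(2) by simp
    then have "dist (sgn q) (sgn v) < d" using d(1) by (intro power2_less_imp_less[of _ d]) auto
    moreover have "v \<noteq> 0" using farey_arc_geometry[OF arc(1)] by auto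
    ultimately have "dist (f (span {sgn q})) (f (span {sgn v})) < e"
      using q(1) arc(2) by (intro d(2)) (auto simp: norm_sgn)
    moreover have "span {q} = span {p}" using q(1) span_scale[of "-1" p] by auto
    ultimately show ?thesis by (simp add: span_sgn dist_real_def)
  qed
  then show thesis using that by blast
qed

section \<open>The mass of a Farey arc\<close>

text \<open>Represents the \<open>k\<close>-th point of the \<open>i\<close>-th Farey sequence, translated by \<open>j\<close>.\<close>

definition farey_vec :: "int \<Rightarrow> nat \<Rightarrow> nat \<Rightarrow> real^2" where
  "farey_vec j i k = vector [farey_num i k + j * farey_den i k, farey_den i k]"

text \<open>The explicit form of a Farey arc, up to sign: either a cell of a translated Farey sequence, or
  a ray that ends at an integer, \<open>[m + 1, \<infinity>]\<close> or \<open>[\<infinity>, - m]\<close>. Halving a ray splits off a unit interval,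
  which is why the cells over \<open>[j, j + 1]\<close> start at depth \<open>|j|\<close>; this depth is the reason for
  the weights \<open>1 / 2 ^ |j|\<close> in the extended Minkowski measure.\<close>

inductive farey_interval :: "nat \<Rightarrow> real^2 \<Rightarrow> real^2 \<Rightarrow> bool" where
  cell: "k < 2 ^ i \<Longrightarrow> farey_interval (nat \<bar>j\<bar> + i) (farey_vec j i k) (farey_vec j i (Suc k))"
| right_ray: "farey_interval m (vector [real m + 1, 1]) (vector [1, 0])"
| left_ray: "farey_interval m (vector [1, 0]) (vector [real m, -1])"

lemma farey_vec_even: "k \<le> 2 ^ i \<Longrightarrow> farey_vec j (Suc i) (2 * k) = farey_vec j i k"
  by (simp add: farey_vec_def farey_even)

lemma farey_vec_odd:
  "k < 2 ^ i \<Longrightarrow> farey_vec j (Suc i) (Suc (2 * k)) = farey_vec j i k + farey_vec j i (Suc k)"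
  by (simp add: farey_vec_def farey_odd vec_eq_iff forall_2) (simp add: algebra_simps)

lemma farey_vec_0: "farey_vec j 0 0 = vector [real_of_int j, 1]"
  "farey_vec j 0 (Suc 0) = vector [real_of_int j + 1, 1]"
  by (simp_all add: farey_vec_def farey_num_def farey_den_def add.commute)

lemma farey_interval_halves:
  assumes "farey_interval n v w"
  defines "P \<equiv> \<lambda>v w. farey_interval (Suc n) v w \<or> farey_interval (Suc n) (- v) (- w)"
  shows "P v (v + w) \<and> P (v + w) w"
  using assms(1) unfolding P_def
proof cases
  case (cell k i j)
  have "Suc (Suc (2 * k)) = 2 * Suc k" by simp
  then show "(farey_interval (Suc n) v (v + w) \<or> farey_interval (Suc n) (- v) (- (v + w))) \<and>
      (farey_interval (Suc n) (v + w) w \<or> farey_interval (Suc n) (- (v + w)) (- w))"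
    using farey_interval.cell[of "2 * k" "Suc i" j] farey_interval.cell[of "Suc (2 * k)" "Suc i" j]
      farey_vec_even[of k i j] farey_vec_even[of "Suc k" i j] farey_vec_odd[of k i j] cell
    by simp
next
  case right_ray
  have e: "v + w = vector [real (Suc n) + 1, 1]"
    by (simp add: right_ray vec_eq_iff forall_2)
  have "farey_interval (Suc n) v (v + w)"
    using farey_interval.cell[of 0 0 "int (Suc n)"] unfolding e
    by (simp add: right_ray farey_vec_0 nat_add_distrib add.commute)
  moreover have "farey_interval (Suc n) (v + w) w"
    unfolding e using farey_interval.right_ray[of "Suc n"] by (simp add: right_ray)
  ultimately show "(farey_interval (Suc n) v (v + w) \<or> farey_interval (Suc n) (- v) (- (v + w))) \<and>
      (farey_interval (Suc n) (v + w) w \<or> farey_interval (Suc n) (- (v + w)) (- w))" by blast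
next
  case left_ray
  have e: "v + w = vector [real (Suc n), -1]"
    by (simp add: left_ray vec_eq_iff forall_2)
  have e2: "- (v + w) = vector [real_of_int (- int (Suc n)), 1]"
    "- w = vector [real_of_int (- int (Suc n)) + 1, 1]"
    by (simp_all add: left_ray vec_eq_iff forall_2)
  \<comment> \<open>The half cut off is the cell over \<open>[- (n + 1), - n]\<close>; its endpoint vectors appear negated because
    the ray has second coordinate \<open>-1\<close> at its finite end.\<close>
  have "farey_interval (Suc n) (- (v + w)) (- w)"
    using farey_interval.cell[of 0 0 "- int (Suc n)"] unfolding e2
    by (simp add: farey_vec_0 nat_add_distrib del: of_int_minus of_int_of_nat_eq)
  moreover have "farey_interval (Suc n) v (v + w)"
    unfolding e using farey_interval.left_ray[of "Suc n"] by (simp add: left_ray)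
  ultimately show "(farey_interval (Suc n) v (v + w) \<or> farey_interval (Suc n) (- v) (- (v + w))) \<and>
      (farey_interval (Suc n) (v + w) w \<or> farey_interval (Suc n) (- (v + w)) (- w))" by blast
qed

lemma farey_arc_interval:
  "farey_arc n v w \<Longrightarrow> farey_interval n v w \<or> farey_interval n (- v) (- w)"
proof -
  have halves: "(farey_interval (Suc n) v (v + w) \<or> farey_interval (Suc n) (- v) (- (v + w))) \<and>
      (farey_interval (Suc n) (v + w) w \<or> farey_interval (Suc n) (- (v + w)) (- w))"
    if "farey_interval n v w \<or> farey_interval n (- v) (- w)" for n v w
  proof -
    have eq: "- v + - w = - (v + w)" by simp
    from that show ?thesis
    proof
      assume "farey_interval n (- v) (- w)"
      from farey_interval_halves[OF this] show ?thesis unfolding eq minus_minus by blast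
    qed (rule farey_interval_halves)
  qed
  show "farey_arc n v w \<Longrightarrow> ?thesis"
  proof (induction rule: farey_arc.induct)
    case (side s)
    then show ?case
      using farey_interval.right_ray[of 0] farey_interval.left_ray[of 0] farey_interval.cell[of 0 0 0]
      by (cases s) (simp_all add: farey_vec_0)
  next
    case (left n v w)
    then show ?case using halves by blast
  next
    case (right n v w)
    then show ?case using halves by blast
  qed auto
qed

lemma measure_farey_interval:
  assumes "farey_interval n v w"
  shows "measure line_measure {t. arc_form v w (line_vec t) \<ge> 0} = 1 / (3 * 2 ^ n)"
  using assms
proof cases
  case (cell k i j)
  define s t where "s = real_of_int j + farey_point i k" and "t = real_of_int j + farey_point i (Suc k)"
  have "s < t" using farey_gap_pos[OF cell(4)] by (simp add: s_def t_def)
  have den: "real_of_int (farey_den i l) > 0" for l using farey_den_pos by simp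
  have form: "arc_form v w (line_vec x) = (farey_den i k * farey_den i (Suc k)) * ((x - s) * (t - x))" for x
  proof -
    have "real_of_int (farey_num i l) = farey_den i l * farey_point i l" for l
      using den[of l] by (simp add: farey_point_eq)
    then show ?thesis
      by (simp add: cell arc_form_def cross_def farey_vec_def s_def t_def) (simp add: algebra_simps)
  qed
  have "arc_form v w (line_vec x) \<ge> 0 \<longleftrightarrow> (x - s) * (t - x) \<ge> 0" for x
    using mult_le_cancel_left_pos[OF mult_pos_pos[OF den[of k] den[of "Suc k"]], of 0 "(x - s) * (t - x)"]
    unfolding form by (simp only: mult_zero_right of_int_mult)
  moreover have "(x - s) * (t - x) \<ge> 0 \<longleftrightarrow> x \<in> {s..t}" for x
    using \<open>s < t\<close> by (auto simp: zero_le_mult_iff)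
  ultimately have arc: "{x. arc_form v w (line_vec x) \<ge> 0} = {s..t}" by blast
  have val: "extended_minkowski (real_of_int j + farey_point i l) =
      (left_mass j + (real l / 2 ^ i) / 2 ^ nat \<bar>j\<bar>) / 3"
    if "l \<le> 2 ^ i" for l
    using farey_point_range[OF that]
    by (subst extended_minkowski_cell[of j]) (simp_all add: minkowski_farey_point that)
  have "extended_minkowski t - extended_minkowski s = 1 / (3 * 2 ^ n)"
    using cell val[of k] val[of "Suc k"] by (simp add: s_def t_def power_add field_simps)
  then show ?thesis unfolding arc using measure_line_Icc[of s t] \<open>s < t\<close> by simp
next
  case right_ray
  have "{t. arc_form v w (line_vec t) \<ge> 0} = {real_of_int (int n + 1)..}"
    by (auto simp: right_ray arc_form_def cross_def)
  then show ?thesis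
    by (simp only: measure_line_Ici extended_minkowski_int)
      (simp add: left_mass_nonneg nat_add_distrib field_simps)
next
  case left_ray
  have "{t. arc_form v w (line_vec t) \<ge> 0} = {..real_of_int (- int n)}"
    by (auto simp: left_ray arc_form_def cross_def)
  then show ?thesis
    by (simp only: measure_line_Iic extended_minkowski_int) (simp add: left_mass_nonpos)
qed

lemma measure_farey_arc:
  "farey_arc n v w \<Longrightarrow> measure line_measure {t. arc_form v w (line_vec t) \<ge> 0} = 1 / (3 * 2 ^ n)"
  using farey_arc_interval[of n v w] measure_farey_interval[of n v w]
    measure_farey_interval[of n "- v" "- w"] by auto

section \<open>Equidistribution of spheres\<close>

text \<open>The endpoints of the arc of the nonempty word \<open>u\<close>.\<close>

definition word_left :: "side list \<Rightarrow> real^2" where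
  "word_left u = word_mat (butlast u) *v left_end (last u)"

definition word_right :: "side list \<Rightarrow> real^2" where
  "word_right u = word_mat (butlast u) *v right_end (last u)"

definition word_form :: "side list \<Rightarrow> real^2 \<Rightarrow> real" where
  "word_form u p = arc_form (word_left u) (word_right u) p"

lemma farey_arc_reduced_word:
  assumes "u \<in> reduced_words (Suc m)"
  shows "farey_arc m (word_left u) (word_right u)"
proof -
  have "u \<noteq> []" using assms by (auto simp: reduced_words_def)
  then show ?thesis
    using assms farey_arc_word[of "butlast u" "last u"]
    by (simp add: reduced_words_def word_left_def word_right_def)
qed

text \<open>All letters of \<open>u\<close> but the last one preserve the form, and the last one changes its sign. So
  the image under \<open>u @ w\<close> lies in the arc of \<open>u\<close> unless the image under \<open>w\<close> is interior to the arc of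
  the last letter of \<open>u\<close>.\<close>

lemma word_form_word_mat:
  assumes "u \<noteq> []"
  shows "word_form u (word_mat (u @ w) *v p) = - side_form (last u) (word_mat w *v p)"
proof -
  have split: "butlast u @ last u # w = u @ w"
    using assms by (metis append.assoc append_Cons append_Nil append_butlast_last_id)
  have "word_mat (u @ w) = word_mat (butlast u) ** (gen (last u) ** word_mat w)"
    using word_mat_append[of "butlast u" "last u # w"] split by simp
  then have "word_mat (u @ w) *v p = word_mat (butlast u) *v (gen (last u) *v (word_mat w *v p))"
    by (simp add: matrix_vector_mul_assoc matrix_mul_assoc)
  then show ?thesis
    by (simp add: word_form_def word_left_def word_right_def arc_form_mult det_word_mat
        side_form_def[symmetric] side_form_gen)
qed

text \<open>The letters are found from the front: apply the letter of an arc that contains the point, and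
  continue with an arc of another side that contains the image.\<close>

lemma word_arcs_cover_aux:
  "side_form t p \<ge> 0 \<Longrightarrow> \<exists>u\<in>reduced_words (Suc m). hd u = t \<and> word_form u p \<ge> 0"
proof (induction m arbitrary: t p)
  case 0
  then show ?case
    by (intro bexI[of _ "[t]"])
      (simp_all add: reduced_words_def word_form_def word_left_def word_right_def side_form_def)
next
  case (Suc m)
  let ?q = "gen t *v p"
  obtain s where s: "s \<noteq> t" "side_form s ?q \<ge> 0"
    using side_form_cover(2)[of t ?q] Suc.prems by (auto simp: side_form_gen)
  obtain u where u: "u \<in> reduced_words (Suc m)" "hd u = s" "word_form u ?q \<ge> 0"
    using Suc.IH[OF s(2)] by blast
  have ne: "u \<noteq> []" using u by (auto simp: reduced_words_def)
  have "gen t *v ?q = - p"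
    by (simp add: matrix_vector_mul_assoc gen_square) (simp add: vec_eq_iff matrix_vector_mult_def
        mat_def sum_2 forall_2)
  then have "word_form (t # u) p = word_form (t # u) (gen t *v ?q)"
    by (simp add: word_form_def)
  also have "\<dots> = word_form u ?q"
    using ne by (simp add: word_form_def word_left_def word_right_def matrix_vector_mul_assoc[symmetric]
        arc_form_mult det_gen)
  finally have "word_form (t # u) p \<ge> 0" using u by simp
  moreover have "t # u \<in> reduced_words (Suc (Suc m))"
    using u s ne by (auto simp: reduced_words_def distinct_adj_Cons)
  ultimately show ?case by (intro bexI[of _ "t # u"]) auto
qed

lemma word_arcs_cover: "\<exists>u\<in>reduced_words (Suc m). word_form u p \<ge> 0"
  using side_form_cover(1)[of p] word_arcs_cover_aux by blast

text \<open>A cover by sets whose probabilities add up to 1 suffices, without disjointness: the shifted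
  function \<open>g + B \<ge> 0\<close> is at most the sum over the cover of its upper bounds on the sets. Applying
  this to \<open>f\<close> and to \<open>- f\<close> gives both inequalities.\<close>

lemma (in prob_space) integral_near_average:
  assumes fin: "finite I" and ev: "\<And>i. i \<in> I \<Longrightarrow> A i \<in> events"
    and prob: "\<And>i. i \<in> I \<Longrightarrow> prob (A i) = 1 / real (card I)"
    and cover: "\<And>x. x \<in> space M \<Longrightarrow> \<exists>i\<in>I. x \<in> A i"
    and f: "f \<in> borel_measurable M" "\<And>x. x \<in> space M \<Longrightarrow> \<bar>f x\<bar> \<le> B"
    and b: "\<And>i. i \<in> I \<Longrightarrow> \<bar>b i\<bar> \<le> B" and "e \<ge> 0"
    and near: "\<And>i x. i \<in> I \<Longrightarrow> x \<in> A i \<Longrightarrow> \<bar>f x - b i\<bar> \<le> e"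
  shows "\<bar>expectation f - (\<Sum>i\<in>I. b i) / real (card I)\<bar> \<le> e"
proof -
  have "I \<noteq> {}" using cover not_empty by blast
  then have card: "real (card I) > 0" using fin by (simp add: card_gt_0_iff)
  have upper: "expectation g \<le> (\<Sum>i\<in>I. c i) / real (card I) + e"
    if g: "g \<in> borel_measurable M" "\<And>x. x \<in> space M \<Longrightarrow> \<bar>g x\<bar> \<le> B"
      and c: "\<And>i. i \<in> I \<Longrightarrow> \<bar>c i\<bar> \<le> B"
      and g_le: "\<And>i x. i \<in> I \<Longrightarrow> x \<in> A i \<Longrightarrow> g x \<le> c i + e" for g c
  proof -
    have int_g: "integrable M g"
      using g by (intro integrable_const_bound[of _ B]) auto
    have "expectation g + B = expectation (\<lambda>x. g x + B)"
      using int_g by (simp add: prob_space)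
    also have "\<dots> \<le> expectation (\<lambda>x. \<Sum>i\<in>I. indicator (A i) x * (c i + e + B))"
    proof (rule integral_mono)
      show "integrable M (\<lambda>x. g x + B)" using int_g by simp
      show "integrable M (\<lambda>x. \<Sum>i\<in>I. indicator (A i) x * (c i + e + B))"
        using ev by (intro Bochner_Integration.integrable_sum integrable_mult_left) (auto simp: less_top[symmetric])
      fix x assume "x \<in> space M"
      then obtain i where i: "i \<in> I" "x \<in> A i" using cover by blast
      have nonneg: "0 \<le> c j + e + B" if "j \<in> I" for j using c[OF that] \<open>e \<ge> 0\<close> by simp
      have "g x + B \<le> indicator (A i) x * (c i + e + B)" using g_le[OF i] i by simp
      also have "\<dots> \<le> (\<Sum>j\<in>I. indicator (A j) x * (c j + e + B))"
        using i fin nonneg by (intro member_le_sum) auto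
      finally show "g x + B \<le> (\<Sum>j\<in>I. indicator (A j) x * (c j + e + B))" .
    qed
    also have "\<dots> = (\<Sum>i\<in>I. prob (A i) * (c i + e + B))"
      using ev by (subst Bochner_Integration.integral_sum) (auto simp: less_top[symmetric])
    also have "\<dots> = (\<Sum>i\<in>I. c i) / real (card I) + e + B"
      using card by (simp add: prob sum.distrib sum_divide_distrib[symmetric] add_divide_distrib)
    finally show ?thesis by simp
  qed
  have "expectation f \<le> (\<Sum>i\<in>I. b i) / real (card I) + e"
    using f b near by (intro upper) (force simp: abs_le_iff)+
  moreover have "expectation (\<lambda>x. - f x) \<le> (\<Sum>i\<in>I. - b i) / real (card I) + e"
    using f b near by (intro upper) (force simp: abs_le_iff)+
  ultimately show ?thesis by (simp add: sum_negf abs_le_iff)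
qed

lemma continuous_proj_of_real:
  assumes "continuous_map proj_top euclideanreal f"
  shows "continuous_on UNIV (\<lambda>t. f (proj_of_real t))"
  unfolding proj_of_real_eq
  by (rule continuous_on_compose2[OF continuous_on_lift[OF assms] continuous_line_vec]) auto

lemma continuous_map_proj_measurable:
  assumes "continuous_map proj_top euclideanreal f"
  shows "f \<in> borel_measurable proj_borel"
proof (rule borel_measurableI)
  fix S :: "real set" assume "open S"
  then have "openin proj_top {x \<in> topspace proj_top. f x \<in> S}"
    using assms by (intro openin_continuous_map_preimage) auto
  moreover have "{x \<in> topspace proj_top. f x \<in> S} = f -` S \<inter> space proj_borel"
    by (auto simp: topspace_proj_top space_proj_borel)
  ultimately show "f -` S \<inter> space proj_borel \<in> sets proj_borel" using openin_proj_borel by metis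
qed

text \<open>The common approximation of the integral and of the sphere averages.\<close>

definition word_average :: "((real^2) set \<Rightarrow> real) \<Rightarrow> nat \<Rightarrow> real" where
  "word_average f m =
    (\<Sum>u\<in>reduced_words (Suc m). f (span {word_left u})) / real (card (reduced_words (Suc m)))"

lemma word_left_nonzero: "u \<in> reduced_words (Suc m) \<Longrightarrow> word_left u \<noteq> 0"
  using farey_arc_geometry[OF farey_arc_reduced_word[of u m]] by auto

lemma integral_near_word_average:
  assumes f: "continuous_map proj_top euclideanreal f"
    and B: "\<And>v. v \<noteq> 0 \<Longrightarrow> \<bar>f (span {v})\<bar> \<le> B" and "e \<ge> 0"
    and osc: "\<And>v w p. \<lbrakk>farey_arc m v w; p \<noteq> 0; arc_form v w p \<ge> 0\<rbrakk> \<Longrightarrow>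
      \<bar>f (span {p}) - f (span {v})\<bar> \<le> e"
  shows "\<bar>(\<integral>y. f y \<partial>minkowski_measure) - word_average f m\<bar> \<le> e"
proof -
  have "(\<integral>y. f y \<partial>minkowski_measure) = line_measure.expectation (\<lambda>t. f (span {line_vec t}))"
    unfolding minkowski_measure_def
    using integral_distr[OF proj_of_real_measurable_line continuous_map_proj_measurable[OF f]]
    by (simp add: proj_of_real_eq)
  moreover have "\<bar>line_measure.expectation (\<lambda>t. f (span {line_vec t})) - word_average f m\<bar> \<le> e"
    unfolding word_average_def
  proof (rule line_measure.integral_near_average[where
        A = "\<lambda>u. {t. word_form u (line_vec t) \<ge> 0}" and B = B])
    fix u assume u: "u \<in> reduced_words (Suc m)"
    have "continuous_on UNIV (\<lambda>t. word_form u (line_vec t))"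
      unfolding word_form_def arc_form_def cross_def
      by (simp add: line_vec_nth) (intro continuous_intros)
    then have "closed {t. word_form u (line_vec t) \<ge> 0}"
      by (intro closed_Collect_le) auto
    then show "{t. word_form u (line_vec t) \<ge> 0} \<in> line_measure.events"
      by (simp add: line_measure_def borel_closed)
    show "line_measure.prob {t. word_form u (line_vec t) \<ge> 0} = 1 / real (card (reduced_words (Suc m)))"
      unfolding word_form_def card_reduced_words
      using measure_farey_arc[OF farey_arc_reduced_word[OF u]] by simp
    show "\<bar>f (span {word_left u})\<bar> \<le> B" by (rule B) (rule word_left_nonzero[OF u])
    fix t assume "t \<in> {t. word_form u (line_vec t) \<ge> 0}"
    then show "\<bar>f (span {line_vec t}) - f (span {word_left u})\<bar> \<le> e"
      using osc[OF farey_arc_reduced_word[OF u], of "line_vec t"] by (simp add: word_form_def)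
  next
    show "(\<lambda>t. f (span {line_vec t})) \<in> borel_measurable line_measure"
      using continuous_proj_of_real[OF f]
      by (simp add: proj_of_real_eq line_measure_def borel_measurable_continuous_onI
          cong: measurable_cong_sets)
  qed (use B \<open>e \<ge> 0\<close> word_arcs_cover in \<open>auto simp: finite_reduced_words\<close>)
  ultimately show ?thesis by simp
qed

lemma word_mat_nonzero: "p \<noteq> 0 \<Longrightarrow> word_mat u *v p \<noteq> 0"
  using det_word_mat[of u]
  by (metis invertible_det_nz matrix_left_invertible_ker invertible_def zero_neq_one)

text \<open>Split each word of the sphere into its first \<open>m + 1\<close> letters \<open>u\<close> and the remaining \<open>k\<close>
  letters. Among the \<open>2 ^ k\<close> words with the same \<open>u\<close>, all but at most one send \<open>p\<close> into the arc of
  \<open>u\<close>, where \<open>f\<close> is within \<open>e\<close> of its value at the left end; the exception costs at most \<open>2 * B\<close>.\<close>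

lemma sphere_average_near_word_average:
  assumes "p \<noteq> 0" and B: "\<And>v. v \<noteq> 0 \<Longrightarrow> \<bar>f (span {v})\<bar> \<le> B" and "e \<ge> 0"
    and osc: "\<And>v w p. \<lbrakk>farey_arc m v w; p \<noteq> 0; arc_form v w p \<ge> 0\<rbrakk> \<Longrightarrow>
      \<bar>f (span {p}) - f (span {v})\<bar> \<le> e"
  shows "\<bar>sphere_sum (Suc m + k) f (span {p}) / real (card (farey_sphere (Suc m + k)))
    - word_average f m\<bar> \<le> e + 2 * B / 2 ^ k"
proof -
  let ?R = "reduced_words (Suc m)"
  let ?g = "\<lambda>u w. f (span {word_mat (u @ w) *v p})" and ?c = "\<lambda>u. f (span {word_left u})"
  have "B \<ge> 0" using B[of p] \<open>p \<noteq> 0\<close> by simp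
  have inner: "(\<Sum>w\<in>extensions (last u) k. \<bar>?g u w - ?c u\<bar>) \<le> 2 ^ k * e + 2 * B" if u: "u \<in> ?R" for u
  proof -
    define bad where "bad = {w \<in> extensions (last u) k. side_form (last u) (word_mat w *v p) > 0}"
    have "w = w'" if "w \<in> bad" "w' \<in> bad" for w w'
      using exceptional_word_unique[of w w' "last u" "last u" p] that
      by (auto simp: bad_def extensions_def)
    then have "card bad \<le> 1"
      using card_le_Suc0_iff_eq[of bad] by (simp add: bad_def finite_extensions)
    have "\<bar>?g u w - ?c u\<bar> \<le> e + (if w \<in> bad then 2 * B else 0)"
      if w: "w \<in> extensions (last u) k" for w
    proof (cases "w \<in> bad")
      case True
      then show ?thesis
        using B[OF word_left_nonzero[OF u]] B[OF word_mat_nonzero[OF \<open>p \<noteq> 0\<close>, of "u @ w"]] \<open>e \<ge> 0\<close>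
        by auto
    next
      case False
      have "u \<noteq> []" using u by (auto simp: reduced_words_def)
      then have "word_form u (word_mat (u @ w) *v p) \<ge> 0"
        using False w by (simp add: word_form_word_mat bad_def)
      then show ?thesis
        using osc[OF farey_arc_reduced_word[OF u] word_mat_nonzero[OF \<open>p \<noteq> 0\<close>]] False
        by (simp add: word_form_def)
    qed
    then have "(\<Sum>w\<in>extensions (last u) k. \<bar>?g u w - ?c u\<bar>) \<le>
        (\<Sum>w\<in>extensions (last u) k. e + (if w \<in> bad then 2 * B else 0))"
      by (intro sum_mono)
    also have "\<dots> = 2 ^ k * e + real (card bad) * (2 * B)"
    proof -
      have "extensions (last u) k \<inter> {w. w \<in> bad} = bad" by (auto simp: bad_def)
      then show ?thesis
        by (simp add: sum.distrib card_extensions sum.If_cases finite_extensions)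
    qed
    also have "\<dots> \<le> 2 ^ k * e + 2 * B"
      using mult_right_mono[of "real (card bad)" 1 "2 * B"] \<open>card bad \<le> 1\<close> \<open>B \<ge> 0\<close> by simp
    finally show ?thesis .
  qed
  define c where "c = real (card ?R)"
  have c: "c > 0" by (simp add: c_def card_reduced_words)
  have card: "real (card (farey_sphere (Suc m + k))) = c * 2 ^ k"
    by (simp add: c_def card_sphere card_reduced_words power_add)
  have "sphere_sum (Suc m + k) f (span {p}) - c * 2 ^ k * word_average f m =
      (\<Sum>u\<in>?R. \<Sum>w\<in>extensions (last u) k. ?g u w - ?c u)"
    using c
    unfolding sphere_sum_eq[OF \<open>p \<noteq> 0\<close>] sum_reduced_words_split[OF zero_less_Suc] word_average_def
    by (simp add: sum_subtractf card_extensions c_def[symmetric] sum_distrib_left[symmetric])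
  then have "\<bar>sphere_sum (Suc m + k) f (span {p}) - c * 2 ^ k * word_average f m\<bar> \<le>
      (\<Sum>u\<in>?R. \<Sum>w\<in>extensions (last u) k. \<bar>?g u w - ?c u\<bar>)"
    by (simp only:) (intro order.trans[OF sum_abs] sum_mono sum_abs)
  also have "\<dots> \<le> (\<Sum>u\<in>?R. 2 ^ k * e + 2 * B)" by (intro sum_mono inner)
  also have "\<dots> = c * 2 ^ k * (e + 2 * B / 2 ^ k)" by (simp add: c_def field_simps)
  finally have "\<bar>sphere_sum (Suc m + k) f (span {p}) - c * 2 ^ k * word_average f m\<bar> / (c * 2 ^ k) \<le>
      e + 2 * B / 2 ^ k"
    using c by (simp add: divide_le_eq mult.commute)
  also have "\<bar>sphere_sum (Suc m + k) f (span {p}) - c * 2 ^ k * word_average f m\<bar> / (c * 2 ^ k) =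
      \<bar>sphere_sum (Suc m + k) f (span {p}) / (c * 2 ^ k) - word_average f m\<bar>"
  proof -
    have "sphere_sum (Suc m + k) f (span {p}) / (c * 2 ^ k) - word_average f m =
        (sphere_sum (Suc m + k) f (span {p}) - c * 2 ^ k * word_average f m) / (c * 2 ^ k)"
      using c by (simp add: diff_divide_distrib)
    then show ?thesis using c by (simp only: abs_divide) simp
  qed
  finally show ?thesis by (simp only: card)
qed

text \<open>Given a precision, first \<open>m\<close> is chosen such that the oscillation on the arcs of depth \<open>m\<close> is
  small, and then \<open>n\<close> so large that the exceptional words, at most one for each word of length \<open>m + 1\<close>, do
  not matter.\<close>

theorem theorem2p1:
  shows "\<exists>\<mu>. extended_minkowski_measure \<mu> \<and>
    (\<forall>x \<in> proj_line. \<forall>f. continuous_map proj_top euclideanreal f \<longrightarrow>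
      (\<lambda>n. sphere_sum n f x / real (card (farey_sphere n))) \<longlonglongrightarrow> (\<integral>y. f y \<partial>\<mu>))"
proof (intro exI[of _ minkowski_measure] conjI ballI allI impI)
  show "extended_minkowski_measure minkowski_measure"
    by (rule extended_minkowski_measure_minkowski_measure)
  fix x and f :: "(real^2) set \<Rightarrow> real"
  assume "x \<in> proj_line" and f: "continuous_map proj_top euclideanreal f"
  then obtain p where p: "x = span {p}" "p \<noteq> 0" by (auto simp: proj_line_def)
  obtain B where B: "\<And>v. v \<noteq> 0 \<Longrightarrow> \<bar>f (span {v})\<bar> \<le> B"
    using continuous_map_proj_bounded[OF f] by blast
  show "(\<lambda>n. sphere_sum n f x / real (card (farey_sphere n))) \<longlonglongrightarrow> (\<integral>y. f y \<partial>minkowski_measure)"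
  proof (rule LIMSEQ_I)
    fix r :: real assume "r > 0"
    then have r: "r / 4 > 0" by simp
    obtain m where osc: "\<And>n v w p. \<lbrakk>n \<ge> m; farey_arc n v w; p \<noteq> 0; arc_form v w p \<ge> 0\<rbrakk> \<Longrightarrow>
        \<bar>f (span {p}) - f (span {v})\<bar> \<le> r / 4"
      using oscillation_on_farey_arcs[OF f r] by metis
    have "(\<lambda>k. 2 * B / 2 ^ k) \<longlonglongrightarrow> 0"
      using tendsto_mult_right_zero[OF LIMSEQ_power_zero[of "1 / 2 :: real"], of "2 * B"]
      by (simp add: power_one_over)
    then obtain K where K: "\<And>k. k \<ge> K \<Longrightarrow> \<bar>2 * B / 2 ^ k\<bar> < r / 4"
      using LIMSEQ_D[OF _ r] by fastforce
    have "norm (sphere_sum n f x / real (card (farey_sphere n)) - (\<integral>y. f y \<partial>minkowski_measure)) < r"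
      if "n \<ge> Suc m + K" for n
    proof -
      define k where "k = n - Suc m"
      have n: "n = Suc m + k" and "k \<ge> K" using that by (simp_all add: k_def)
      have "\<bar>sphere_sum n f x / real (card (farey_sphere n)) - word_average f m\<bar> \<le> r / 4 + 2 * B / 2 ^ k"
        unfolding n p(1) using p B r osc[OF order.refl]
        by (intro sphere_average_near_word_average) auto
      moreover have "\<bar>(\<integral>y. f y \<partial>minkowski_measure) - word_average f m\<bar> \<le> r / 4"
        using r by (intro integral_near_word_average[OF f B _ osc[OF order.refl]]) auto
      ultimately show ?thesis using K[OF \<open>k \<ge> K\<close>] \<open>r > 0\<close> unfolding real_norm_def by linarith
    qed
    then show "\<exists>no. \<forall>n\<ge>no. norm (sphere_sum n f x / real (card (farey_sphere n)) -
        (\<integral>y. f y \<partial>minkowski_measure)) < r" by blast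
  qed
qed

end
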